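(* Let $p>5$ be a prime, and let $\varepsilon_p=1,-1,0$ according as $p\equiv\pm1$, $\pm2$ or $\pm4\pmod 9$. (i) If $p\equiv1,4\pmod{15}$, so that $p=x^2+15y^2$ with $x,y\in\mathbb Z$, then $$2\sum_{k=0}^{[p/6]}\frac{\binom{6k}{2k}}{27^{2k}}-\varepsilon_p\equiv\sum_{k=0}^{[p/3]}\frac{\binom{3k}k}{(-27)^k}\equiv\begin{cases}1\pmod p&\text{if }3\mid y,\\ (x-5y)/(10y)\pmod p&\text{if }3\mid y-x.\end{cases}$$ (ii) If $p\equiv2,8\pmod{15}$, so that $p=5x^2+3y^2$ with $x,y\in\mathbb Z$, then $$2\sum_{k=0}^{[p/6]}\frac{\binom{6k}{2k}}{27^{2k}}-\varepsilon_p\equiv\sum_{k=0}^{[p/3]}\frac{\binom{3k}k}{(-27)^k}\equiv\begin{cases}1\pmod p&\text{if }3\mid y,\\ -(x+y)/(2y)\pmod p&\text{if }3\mid y-x.\end{cases}$$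
   Context: $[x]$ is the greatest integer not exceeding $x$. Quotients are interpreted modulo $p$. *)

theory Defs
  imports "HOL-Number_Theory.Number_Theory" "HOL-Number_Theory.Modular_Inverse"
begin

text \<open>
  The quotient \<open>a / b\<close> modulo \<open>p\<close>. It is meaningful only if \<open>b\<close> is coprime to \<open>p\<close>;
  the lemmas below confirm this for every denominator to which it is applied.
\<close>

definition quot_mod :: "nat \<Rightarrow> int \<Rightarrow> int \<Rightarrow> int" where
  "quot_mod p a b = a * modular_inverse (int p) b"

text \<open>The last case is \<open>p \<equiv> \<plusminus>4 (mod 9)\<close>, since the argument will be a prime greater than 5.\<close>

definition eps :: "nat \<Rightarrow> int" where
  "eps p =
     (if [int p = 1] (mod 9) \<or> [int p = - 1] (mod 9) then 1
      else if [int p = 2] (mod 9) \<or> [int p = - 2] (mod 9) then - 1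
      else 0)"

lemma eps_last_case:
  assumes "prime p" "p > 5"
    and "\<not> ([int p = 1] (mod 9) \<or> [int p = - 1] (mod 9))"
    and "\<not> ([int p = 2] (mod 9) \<or> [int p = - 2] (mod 9))"
  shows "[int p = 4] (mod 9) \<or> [int p = - 4] (mod 9)"
proof -
  have "\<not> 3 dvd p"
    using assms(1,2) primes_dvd_imp_eq[of 3 p] by auto
  then have "\<not> 3 dvd int p"
    by presburger
  then have *: "\<not> 3 dvd int p mod 9"
    by (simp add: dvd_mod_iff)
  have "int p mod 9 \<in> {0..<9}"
    by simp
  also have "{0..<9} = {0, 1, 2, 3, 4, 5, 6, 7, 8 :: int}"
    by auto
  finally show ?thesis
    using * assms(3,4) unfolding cong_def by auto
qed

lemma coprime_small:
  assumes "prime p" "p > 5" "c \<in> {2, 3, 5}"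
  shows "coprime (int c) (int p)"
proof -
  have "prime c"
    using assms(3) by auto
  then have "coprime c p"
    using assms by (intro primes_coprime) auto
  then show ?thesis
    by simp
qed

lemma coprime_denominator_sums:
  assumes "prime p" "p > 5"
  shows "coprime (27 ^ k :: int) (int p)" "coprime ((- 27) ^ k :: int) (int p)"
proof -
  have "coprime (3 :: int) (int p)"
    using coprime_small[OF assms, of 3] by simp
  then have "coprime (3 * 3 * 3 :: int) (int p)"
    by (simp only: coprime_mult_left_iff)
  then have "coprime (27 :: int) (int p)"
    by simp
  then show "coprime (27 ^ k :: int) (int p)" "coprime ((- 27) ^ k :: int) (int p)"
    by simp_all
qed

lemma coprime_denominator_form:
  fixes a b x y :: int
  assumes "prime p" "p > 5" "coprime a (int p)" "int p = a * x^2 + b * y^2"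
  shows "coprime (2 * y) (int p)" "coprime (10 * y) (int p)"
proof -
  have pr: "prime (int p)"
    using assms(1) by simp
  have "\<not> int p dvd y"
  proof
    assume y: "int p dvd y"
    then have "int p dvd a * x^2 + b * y^2 - b * y^2"
      using assms(4) by (intro dvd_diff) (auto simp: power2_eq_square)
    then have "int p dvd a * x^2"
      by simp
    then have "int p dvd x^2"
      using assms(3) coprime_dvd_mult_right_iff[of "int p" a "x^2"]
      by (simp add: coprime_commute)
    then have "int p dvd x"
      using prime_dvd_power[OF pr] by blast
    with y have "(int p)^2 dvd a * x^2 + b * y^2"
      by (intro dvd_add dvd_mult dvd_power_same)
    then have "int p * int p dvd int p * 1"
      using assms(4) by (simp add: power2_eq_square)
    then have "int p dvd 1"
      using assms(2) by (subst (asm) dvd_mult_cancel_left) auto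
    with assms(2) show False
      by simp
  qed
  then have y: "coprime y (int p)"
    using pr prime_imp_coprime coprime_commute by blast
  have 2: "coprime 2 (int p)" and 5: "coprime 5 (int p)"
    using coprime_small[OF assms(1,2), of 2] coprime_small[OF assms(1,2), of 5] by simp_all
  show "coprime (2 * y) (int p)"
    using 2 y by simp
  have "coprime (2 * 5 * y) (int p)"
    using 2 5 y by (simp only: coprime_mult_left_iff)
  then show "coprime (10 * y) (int p)"
    by simp
qed

end

theory Submission
  imports Defs "HOL-Computational_Algebra.Polynomial" "HOL-Library.Discrete_Functions"
begin

text \<open>
  With \<open>n = [p/3]\<close>, the quotient of \<open>3k choose k\<close> by \<open>(- 27)\<^sup>k\<close> is congruent to \<open>n + k choose 2k\<close>
  modulo \<open>p\<close>. Hence the second sum is the Fibonacci number \<open>F = F(2n + 1)\<close>, while twice the first sum,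
  which collects the even \<open>k\<close>, exceeds \<open>F\<close> by a sequence of period 6 in \<open>n\<close>.

  By Binet's formula \<open>F\<close> is determined modulo \<open>p\<close> by the cubic residue symbol of the golden ratio.
  Modulo \<open>p\<close>, the square root of 5 is a rational multiple of the square root \<open>\<theta>\<close> of \<open>- 3\<close>, and this is
  the symbol of \<open>A = x + y \<theta>\<close>. Cubic reciprocity between \<open>A\<close> and rational primes makes it
  a character of \<open>p\<close> modulo \<open>N(A) = x\<^sup>2 + 3 y\<^sup>2\<close>, where \<open>p \<equiv> \<plusminus>(x - 3 y)(x + 3 y)\<close>. Modulo a prime \<open>q\<close>
  dividing \<open>x \<plusminus> 3 y\<close>, \<open>A\<close> is an integer times \<open>\<theta>\<close> times a cube root of unity, so a second use of
  reciprocity leaves only the symbols of \<open>\<omega>\<close>, which depend on residues modulo 9.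

  The reciprocity law comes from the Gauss sum \<open>G\<close> of a cubic character modulo a prime \<open>r\<close>, taken in the
  group ring \<open>\<int>[\<omega>][X]/(X\<^sup>r - 1)\<close>, where \<open>G\<^sup>4 = r J G\<close> for the Jacobi sum \<open>J\<close>, by comparing this with
  the Frobenius formula for \<open>G\<close> to the power \<open>q\<^sup>2\<close> modulo \<open>q\<close>.
\<close>

section \<open>Congruences modulo two ring elements\<close>

definition cong2 :: "'a::comm_ring_1 \<Rightarrow> 'a \<Rightarrow> 'a \<Rightarrow> 'a \<Rightarrow> bool" where
  "cong2 m n a b \<longleftrightarrow> (\<exists>u v. a - b = m * u + n * v)"

abbreviation cong2_notation  ("(\<open>indent=1\<close>[_ = _] '(' mod _, _'))") where
  "[a = b] (mod m, n) \<equiv> cong2 m n a b"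

lemma cong2I: "a - b = m * u + n * v \<Longrightarrow> [a = b] (mod m, n)"
  unfolding cong2_def by blast

lemma cong2E:
  assumes "[a = b] (mod m, n)"
  obtains u v where "a - b = m * u + n * v"
  using assms unfolding cong2_def by blast

lemma cong2_refl [simp, intro]: "[a = a] (mod m, n)"
  by (rule cong2I[of _ _ _ 0 _ 0]) simp

lemma cong2_sym: 
  assumes "[a = b] (mod m, n)"
  shows "[b = a] (mod m, n)"
proof -
  obtain u v where "a - b = m * u + n * v" using assms by (rule cong2E)
  then have "b - a = m * (- u) + n * (- v)" by (simp add: algebra_simps)
  then show ?thesis by (rule cong2I)
qed

lemma cong2_add:
  assumes "[a = b] (mod m, n)" "[c = d] (mod m, n)"
  shows "[a + c = b + d] (mod m, n)"
proof -
  obtain u v where "a - b = m * u + n * v" using assms(1) by (rule cong2E)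
  moreover obtain u' v' where "c - d = m * u' + n * v'" using assms(2) by (rule cong2E)
  ultimately have "a + c - (b + d) = m * (u + u') + n * (v + v')" by (simp add: algebra_simps)
  then show ?thesis by (rule cong2I)
qed

lemma cong2_scalar_left:
  assumes "[a = b] (mod m, n)"
  shows "[c * a = c * b] (mod m, n)"
proof -
  obtain u v where "a - b = m * u + n * v" using assms by (rule cong2E)
  then have "c * a - c * b = m * (c * u) + n * (c * v)"
    by (simp add: algebra_simps flip: right_diff_distrib)
  then show ?thesis by (rule cong2I)
qed

lemma cong2_trans [trans]:
  "[a = b] (mod m, n) \<Longrightarrow> [b = c] (mod m, n) \<Longrightarrow> [a = c] (mod m, n)"
  using cong2_add[of m n a b b c] by (auto simp: cong2_def)

lemma cong2_mult:
  assumes "[a = b] (mod m, n)" "[c = d] (mod m, n)"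
  shows "[a * c = b * d] (mod m, n)"
proof -
  have "[a * c = a * d] (mod m, n)" using assms(2) by (rule cong2_scalar_left)
  also have "a * d = d * a" by (rule mult.commute)
  also have "[\<dots> = d * b] (mod m, n)" using assms(1) by (rule cong2_scalar_left)
  finally show ?thesis by (simp add: mult.commute)
qed

lemma cong2_uminus: "[a = b] (mod m, n) \<Longrightarrow> [- a = - b] (mod m, n)"
  using cong2_scalar_left[of m n a b "- 1"] by simp

lemma cong2_diff:
  "[a = b] (mod m, n) \<Longrightarrow> [c = d] (mod m, n) \<Longrightarrow> [a - c = b - d] (mod m, n)"
  using cong2_add[of m n a b "- c" "- d"] cong2_uminus[of m n c d] by simp

lemma cong2_power: "[a = b] (mod m, n) \<Longrightarrow> [a ^ k = b ^ k] (mod m, n)"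
  by (induction k) (auto intro: cong2_mult)

lemma cong2_sum:
  "(\<And>x. x \<in> S \<Longrightarrow> [f x = g x] (mod m, n)) \<Longrightarrow> [sum f S = sum g S] (mod m, n)"
  by (induction S rule: infinite_finite_induct) (auto intro: cong2_add)

lemma cong2_of_dvd_left: "m dvd a - b \<Longrightarrow> [a = b] (mod m, n)"
  by (elim dvdE, rule cong2I[where v = 0]) simp

lemma cong2_of_dvd_right: "n dvd a - b \<Longrightarrow> [a = b] (mod m, n)"
  by (elim dvdE, rule cong2I[where u = 0]) simp

lemma cong2_0_iff: "[a = b] (mod m, 0) \<longleftrightarrow> m dvd a - b"
  by (auto simp: cong2_def dvd_def)

lemma freshmans_dream_cong2:
  fixes a b :: "'a::comm_ring_1"
  assumes "prime q"
  shows "[(a + b) ^ q = a ^ q + b ^ q] (mod of_nat q, n)"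
proof (rule cong2_of_dvd_left)
  let ?f = "\<lambda>k. of_nat (q choose k) * a ^ k * b ^ (q - k)"
  have "q > 0" using assms by (rule prime_gt_0_nat)
  then have "{..q} = insert 0 (insert q {0<..<q})" by auto
  then have "(a + b) ^ q = b ^ q + (a ^ q + sum ?f {0<..<q})"
    using \<open>q > 0\<close> by (simp add: binomial_ring)
  then have "(a + b) ^ q - (a ^ q + b ^ q) = sum ?f {0<..<q}" by simp
  also have "of_nat q dvd \<dots>"
  proof (intro dvd_sum dvd_mult2)
    fix k assume "k \<in> {0<..<q}"
    then have "q dvd (q choose k)" using assms by (intro dvd_choose_prime) auto
    then show "of_nat q dvd (of_nat (q choose k) :: 'a)" by (auto elim!: dvdE)
  qed
  finally show "of_nat q dvd (a + b) ^ q - (a ^ q + b ^ q)" .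
qed

lemma freshmans_dream_sum_cong2:
  fixes f :: "'b \<Rightarrow> 'a::comm_ring_1"
  assumes "prime q"
  shows "[(\<Sum>x\<in>S. f x) ^ q = (\<Sum>x\<in>S. f x ^ q)] (mod of_nat q, n)"
proof (induction S rule: infinite_finite_induct)
  case (insert x S)
  have "[(f x + sum f S) ^ q = f x ^ q + sum f S ^ q] (mod of_nat q, n)"
    using assms by (rule freshmans_dream_cong2)
  also have "[\<dots> = f x ^ q + (\<Sum>x\<in>S. f x ^ q)] (mod of_nat q, n)"
    by (intro cong2_add cong2_refl insert.IH)
  finally show ?case using insert.hyps by simp
qed (use prime_gt_0_nat[OF assms] in \<open>auto simp: power_0_left\<close>)

lemma freshmans_dream_sum_power_cong2:
  fixes f :: "'b \<Rightarrow> 'a::comm_ring_1"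
  assumes "prime q"
  shows "[(\<Sum>x\<in>S. f x) ^ (q ^ k) = (\<Sum>x\<in>S. f x ^ (q ^ k))] (mod of_nat q, n)"
proof (induction k)
  case (Suc k)
  have "(\<Sum>x\<in>S. f x) ^ (q ^ Suc k) = ((\<Sum>x\<in>S. f x) ^ (q ^ k)) ^ q"
    by (simp add: mult.commute flip: power_mult)
  also have "[\<dots> = (\<Sum>x\<in>S. f x ^ (q ^ k)) ^ q] (mod of_nat q, n)"
    using Suc.IH by (rule cong2_power)
  also have "[\<dots> = (\<Sum>x\<in>S. (f x ^ (q ^ k)) ^ q)] (mod of_nat q, n)"
    using assms by (rule freshmans_dream_sum_cong2)
  also have "\<dots> = (\<Sum>x\<in>S. f x ^ (q ^ Suc k))"
    by (simp add: mult.commute flip: power_mult)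
  finally show ?case .
qed simp

section \<open>Eisenstein integers\<close>

datatype eis = Eis (re: int) (om: int)

instantiation eis :: comm_ring_1
begin

definition "0 = Eis 0 0"
definition "1 = Eis 1 0"
definition "a + b = Eis (re a + re b) (om a + om b)"
definition "a - b = Eis (re a - re b) (om a - om b)"
definition "- a = Eis (- re a) (- om a)"
definition "a * b = Eis (re a * re b - om a * om b) (re a * om b + om a * re b - om a * om b)"

instance
  by standard (auto simp: zero_eis_def one_eis_def plus_eis_def minus_eis_def uminus_eis_def
      times_eis_def algebra_simps)

end

lemma eis_sel [simp]:
  "re 0 = 0" "om 0 = 0" "re 1 = 1" "om 1 = 0"
  "re (a + b) = re a + re b" "om (a + b) = om a + om b"
  "re (a - b) = re a - re b" "om (a - b) = om a - om b"
  "re (- a) = - re a" "om (- a) = - om a"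
  "re (a * b) = re a * re b - om a * om b"
  "om (a * b) = re a * om b + om a * re b - om a * om b"
  by (simp_all add: zero_eis_def one_eis_def plus_eis_def minus_eis_def uminus_eis_def
    times_eis_def)

lemma eis_eqI: "re a = re b \<Longrightarrow> om a = om b \<Longrightarrow> a = b"
  by (rule eis.expand) simp

lemma eis_sel_of_nat [simp]: "re (of_nat n) = int n" "om (of_nat n) = 0"
  by (induction n) simp_all

lemma eis_sel_of_int [simp]: "re (of_int k) = k" "om (of_int k) = 0"
  by (cases k; simp)+

lemma eis_sel_numeral [simp]: "re (numeral k) = numeral k" "om (numeral k) = 0"
  using eis_sel_of_int[of "numeral k"] by simp_all

lemma of_int_dvd_eis_iff: "of_int q dvd a \<longleftrightarrow> q dvd re a \<and> q dvd om a"
proof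
  assume "q dvd re a \<and> q dvd om a"
  then obtain u v where "re a = q * u" "om a = q * v" by (auto elim!: dvdE)
  then have "a = of_int q * Eis u v" by (intro eis_eqI) simp_all
  then show "of_int q dvd a" by simp
qed (auto elim!: dvdE)

lemma of_nat_dvd_eis_iff: "of_nat q dvd a \<longleftrightarrow> int q dvd re a \<and> int q dvd om a"
  using of_int_dvd_eis_iff[of "int q" a] by simp

definition \<omega> :: eis where "\<omega> = Eis 0 1"

definition \<theta> :: eis where "\<theta> = Eis 1 2"

definition econj :: "eis \<Rightarrow> eis" where "econj a = Eis (re a - om a) (- om a)"

definition enorm :: "eis \<Rightarrow> int" where "enorm a = (re a)\<^sup>2 - re a * om a + (om a)\<^sup>2"

lemma omega_sel [simp]: "re \<omega> = 0" "om \<omega> = 1"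
  by (simp_all add: \<omega>_def)

lemma theta_sel [simp]: "re \<theta> = 1" "om \<theta> = 2"
  by (simp_all add: \<theta>_def)

lemma econj_sel [simp]: "re (econj a) = re a - om a" "om (econj a) = - om a"
  by (simp_all add: econj_def)

lemma eis_eq: "a = of_int (re a) + of_int (om a) * \<omega>"
  by (rule eis_eqI) simp_all

lemma omega_square: "\<omega>\<^sup>2 = - 1 - \<omega>"
  by (rule eis_eqI) (simp_all add: power2_eq_square)

lemma omega_cube [simp]: "\<omega> ^ 3 = 1"
  by (rule eis_eqI) (simp_all add: power3_eq_cube)

lemma omega_power_mod: "\<omega> ^ (n mod 3) = \<omega> ^ n"
proof -
  have "\<omega> ^ n = \<omega> ^ (3 * (n div 3) + n mod 3)" by simp
  also have "\<dots> = \<omega> ^ (n mod 3)" by (simp only: power_add power_mult omega_cube power_one mult_1)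
  finally show ?thesis by (rule sym)
qed

lemma omega_power_cube [simp]: "(\<omega> ^ n) ^ 3 = 1"
  by (metis mult.commute omega_cube power_mult power_one)

lemma econj_simps [simp]:
  "econj (a * b) = econj a * econj b" "econj (a + b) = econj a + econj b"
  "econj (a - b) = econj a - econj b" "econj (- a) = - econj a" "econj (econj a) = a"
  "econj 0 = 0" "econj 1 = 1" "econj (of_int k) = of_int k" "econj (of_nat n) = of_nat n"
  by (rule eis_eqI; simp add: algebra_simps)+

lemma econj_power [simp]: "econj (a ^ n) = econj a ^ n"
  by (induction n) simp_all

lemma econj_sum [simp]: "econj (sum f S) = (\<Sum>x\<in>S. econj (f x))"
  by (induction S rule: infinite_finite_induct) simp_all

lemma econj_omega: "econj \<omega> = \<omega>\<^sup>2"
  by (rule eis_eqI) (simp_all add: power2_eq_square)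

lemma mult_econj: "a * econj a = of_int (enorm a)"
  by (rule eis_eqI) (simp_all add: enorm_def power2_eq_square algebra_simps)

lemma enorm_simps [simp]:
  "enorm (a * b) = enorm a * enorm b" "enorm (econj a) = enorm a" "enorm (- a) = enorm a"
  "enorm 1 = 1" "enorm (of_int k) = k\<^sup>2" "enorm (of_nat n) = (int n)\<^sup>2"
  "enorm \<omega> = 1" "enorm \<theta> = 3"
  by (simp_all add: enorm_def power2_eq_square algebra_simps)

lemma enorm_power [simp]: "enorm (a ^ n) = enorm a ^ n"
  by (induction n) simp_all

lemma four_enorm: "4 * enorm a = (2 * re a - om a)\<^sup>2 + 3 * (om a)\<^sup>2"
  by (simp add: enorm_def power2_eq_square algebra_simps)

lemma enorm_nonneg: "enorm a \<ge> 0"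
  using four_enorm[of a] by (smt (verit) zero_le_power2)

lemma enorm_eq_0_iff: "enorm a = 0 \<longleftrightarrow> a = 0"
proof
  assume "enorm a = 0"
  then have "(2 * re a - om a)\<^sup>2 = 0 \<and> (om a)\<^sup>2 = 0"
    using four_enorm[of a] by (smt (verit) zero_le_power2)
  then show "a = 0" by (intro eis_eqI) auto
qed (simp add: enorm_def)

instance eis :: idom
  by standard (metis enorm_eq_0_iff enorm_simps(1) mult_eq_0_iff)

instance eis :: ring_char_0
  by standard (metis injI eis_sel_of_nat(1) of_nat_eq_iff)

lemma eis_cube_eq_1_iff: "(a :: eis) ^ 3 = 1 \<longleftrightarrow> a \<in> {1, \<omega>, \<omega>\<^sup>2}"
proof -
  have "(a - 1) * ((a - \<omega>) * (a - \<omega>\<^sup>2)) = a ^ 3 - 1"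
    unfolding omega_square
    by (rule eis_eqI) (simp_all add: power3_eq_cube algebra_simps)
  then have "a ^ 3 = 1 \<longleftrightarrow> (a - 1) * ((a - \<omega>) * (a - \<omega>\<^sup>2)) = 0" by simp
  then show ?thesis by simp
qed

lemma econj_cube_root_of_unity:
  assumes "(a :: eis) ^ 3 = 1"
  shows "econj a = a\<^sup>2"
proof -
  have "(\<omega>\<^sup>2)\<^sup>2 = \<omega>" by (rule eis_eqI) (simp_all add: power2_eq_square)
  then show ?thesis using assms unfolding eis_cube_eq_1_iff by (auto simp: econj_omega)
qed

section \<open>The theorems of Fermat and Frobenius for Eisenstein integers\<close>

abbreviation eis_cong :: "eis \<Rightarrow> eis \<Rightarrow> nat \<Rightarrow> bool"  ("(\<open>indent=1\<close>[_ \<equiv> _] '(' mod _'))") where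
  "[a \<equiv> b] (mod q) \<equiv> [a = b] (mod of_nat q, 0)"

lemma eis_cong_iff:
  "[a \<equiv> b] (mod q) \<longleftrightarrow> [re a = re b] (mod int q) \<and> [om a = om b] (mod int q)"
  by (simp add: cong2_0_iff of_nat_dvd_eis_iff cong_iff_dvd_diff)

lemma eis_cong_of_int_iff: "[of_int a \<equiv> of_int b] (mod q) \<longleftrightarrow> [a = b] (mod int q)"
  by (simp add: eis_cong_iff)

lemma eis_cong_econj: "[a \<equiv> b] (mod q) \<Longrightarrow> [econj a \<equiv> econj b] (mod q)"
  by (auto simp: eis_cong_iff cong_minus_minus_iff intro: cong_diff)

lemma eis_cong_mult_of_int_cancel:
  assumes "coprime c (int q)" "[of_int c * a \<equiv> of_int c * b] (mod q)"
  shows "[a \<equiv> b] (mod q)"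
  using assms by (simp add: eis_cong_iff cong_mult_lcancel)

lemma cube_roots_of_unity_cong_imp_eq:
  assumes "prime q" "a ^ 3 = 1" "b ^ 3 = 1" "[a \<equiv> b] (mod q)"
  shows "a = b"
proof (rule ccontr)
  assume "a \<noteq> b"
  have "\<not> int q dvd 1" using prime_gt_1_nat[OF assms(1)] by auto
  with assms \<open>a \<noteq> b\<close> show False
    unfolding eis_cube_eq_1_iff cong2_0_iff of_nat_dvd_eis_iff by (auto simp: omega_square)
qed

lemma prime_mod_3:
  assumes "prime (q :: nat)" "q \<noteq> 3"
  shows "q mod 3 = 1 \<or> q mod 3 = 2"
proof -
  have "\<not> 3 dvd q" using assms primes_dvd_imp_eq[of 3 q] by auto
  then show ?thesis by presburger
qed

lemma power_prime_cong_int: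
  assumes "prime p"
  shows "[a ^ p = a] (mod int p)"
proof -
  define n where "n = nat (a mod int p)"
  have n: "[a = int n] (mod int p)" using prime_gt_0_nat[OF assms] by (simp add: n_def)
  have "[n * n ^ (p - 1) = n] (mod p)"
  proof (cases "p dvd n")
    case False
    then show ?thesis using cong_scalar_left[OF fermat_theorem[OF assms]] by fastforce
  qed (simp add: cong_def)
  then have "[n ^ p = n] (mod p)" using prime_gt_0_nat[OF assms] by (simp add: power_eq_if)
  then have "[int n ^ p = int n] (mod int p)" by (simp flip: of_nat_power cong_int_iff)
  then show ?thesis using cong_pow[OF n] cong_sym[OF n] cong_trans by blast
qed

lemma frobenius_eis:
  assumes "prime p" "p \<noteq> 3"
  shows "[z ^ p \<equiv> (if p mod 3 = 1 then z else econj z)] (mod p)"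
proof -
  have fermat: "[of_int a ^ p \<equiv> of_int a] (mod p)" for a
    using power_prime_cong_int[OF assms(1), of a] by (simp flip: of_int_power eis_cong_of_int_iff)
  define u where "u = (if p mod 3 = 1 then \<omega> else econj \<omega>)"
  have omega_power: "\<omega> ^ p = u"
    using prime_mod_3[OF assms] omega_power_mod[of p] by (auto simp: u_def econj_omega)
  have "z ^ p = (of_int (re z) + of_int (om z) * \<omega>) ^ p" by (simp flip: eis_eq)
  also have "[\<dots> \<equiv> of_int (re z) ^ p + (of_int (om z) * \<omega>) ^ p] (mod p)"
    using assms(1) by (rule freshmans_dream_cong2)
  also have "of_int (re z) ^ p + (of_int (om z) * \<omega>) ^ p
      = of_int (re z) ^ p + of_int (om z) ^ p * u"
    by (simp add: power_mult_distrib omega_power)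
  also have "[\<dots> \<equiv> of_int (re z) + of_int (om z) * u] (mod p)"
    by (intro cong2_add cong2_mult cong2_refl fermat)
  also have "of_int (re z) + of_int (om z) * u = (if p mod 3 = 1 then z else econj z)"
    by (auto simp: u_def intro: eis_eqI)
  finally show ?thesis .
qed

lemma eis_power_prime_square_cong:
  assumes "prime p" "p \<noteq> 3"
  shows "[z ^ p\<^sup>2 \<equiv> z] (mod p)"
proof -
  let ?frob = "\<lambda>z. if p mod 3 = 1 then z else econj z"
  have "z ^ p\<^sup>2 = (z ^ p) ^ p" by (simp add: power2_eq_square power_mult)
  also have "[\<dots> \<equiv> ?frob z ^ p] (mod p)" by (intro cong2_power frobenius_eis assms)
  also have "[\<dots> \<equiv> ?frob (?frob z)] (mod p)" by (intro frobenius_eis assms)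
  also have "\<dots> = z" by simp
  finally show ?thesis .
qed

lemma fermat_eis:
  assumes "prime p" "p \<noteq> 3" "\<not> int p dvd enorm a"
  shows "[a ^ (p\<^sup>2 - 1) \<equiv> 1] (mod p)"
proof (rule eis_cong_mult_of_int_cancel)
  show "coprime (enorm a) (int p)"
    using assms by (simp add: prime_imp_coprime coprime_commute)
  have "p\<^sup>2 = Suc (p\<^sup>2 - 1)" using prime_gt_0_nat[OF assms(1)] by simp
  then have "of_int (enorm a) * a ^ (p\<^sup>2 - 1) = econj a * a ^ p\<^sup>2"
    by (metis mult.assoc mult.commute mult_econj power_Suc)
  also have "[\<dots> \<equiv> econj a * a] (mod p)"
    using assms by (intro cong2_mult cong2_refl eis_power_prime_square_cong)
  also have "econj a * a = of_int (enorm a) * 1" by (simp add: mult.commute flip: mult_econj)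
  finally show "[of_int (enorm a) * a ^ (p\<^sup>2 - 1) \<equiv> of_int (enorm a) * 1] (mod p)" .
qed

lemma prime_dvd_enorm_cong_1:
  assumes "prime r" "r \<noteq> 3" "int r dvd enorm a" "\<not> of_nat r dvd a"
  shows "[r = 1] (mod 3)"
proof (rule ccontr)
  assume "\<not> [r = 1] (mod 3)"
  then have "[a ^ r \<equiv> econj a] (mod r)"
    using frobenius_eis[OF assms(1,2), of a] by (simp add: cong_def)
  then have "[a * a ^ r \<equiv> of_int (enorm a)] (mod r)"
    using cong2_scalar_left[of _ _ "a ^ r" "econj a" a] by (simp add: mult_econj)
  also have "[of_int (enorm a) \<equiv> of_int 0] (mod r)"
    unfolding eis_cong_of_int_iff using assms(3) by (simp add: cong_0_iff)
  finally have "[a ^ Suc r \<equiv> 0] (mod r)" by simp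
  then have "of_nat r dvd a ^ Suc r" by (simp add: cong2_0_iff)
  also have "a ^ Suc r dvd a ^ r\<^sup>2"
  proof (rule le_imp_power_dvd)
    have "2 * r \<le> r\<^sup>2" using prime_ge_2_nat[OF assms(1)] by (simp add: power2_eq_square)
    then show "Suc r \<le> r\<^sup>2" using prime_ge_2_nat[OF assms(1)] by simp
  qed
  finally have "of_nat r dvd a ^ r\<^sup>2" .
  moreover have "of_nat r dvd a ^ r\<^sup>2 - a"
    using eis_power_prime_square_cong[OF assms(1,2)] by (simp add: cong2_0_iff)
  ultimately have "of_nat r dvd a" by (metis dvd_diff_right_iff)
  then show False using assms(4) by blast
qed

section \<open>The group ring of a finite cyclic group\<close>

definition periodic :: "nat \<Rightarrow> (int \<Rightarrow> 'a) \<Rightarrow> bool" where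
  "periodic r f \<longleftrightarrow> (\<forall>a b. [a = b] (mod int r) \<longrightarrow> f a = f b)"

lemma periodicI: "(\<And>a b. [a = b] (mod int r) \<Longrightarrow> f a = f b) \<Longrightarrow> periodic r f"
  by (simp add: periodic_def)

lemma periodicD: "periodic r f \<Longrightarrow> [a = b] (mod int r) \<Longrightarrow> f a = f b"
  by (simp add: periodic_def)

lemma sum_residues_affine:
  fixes f :: "int \<Rightarrow> 'a::comm_monoid_add"
  assumes "r > 0" "periodic r f" "coprime a (int r)"
  shows "(\<Sum>s\<in>{0..<int r}. f (a * s + b)) = (\<Sum>s\<in>{0..<int r}. f s)"
proof -
  let ?I = "{0..<int r}" and ?h = "\<lambda>s. (a * s + b) mod int r"
  have inj: "inj_on ?h ?I"
  proof (rule inj_onI)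
    fix s t assume st: "s \<in> ?I" "t \<in> ?I" "?h s = ?h t"
    then have "[a * s + b = a * t + b] (mod int r)" by (simp add: cong_def)
    then have "[s = t] (mod int r)"
      using assms(3) by (simp add: cong_add_rcancel cong_mult_lcancel)
    then show "s = t" using st(1,2) by (intro cong_less_imp_eq_int) auto
  qed
  moreover have "?h ` ?I \<subseteq> ?I" using assms(1) by (intro image_subsetI) simp
  ultimately have "?h ` ?I = ?I" by (intro endo_inj_surj) simp_all
  then have "(\<Sum>s\<in>?I. f s) = (\<Sum>s\<in>?I. f (?h s))"
    using sum.reindex[OF inj, of f] by (simp add: o_def)
  also have "\<dots> = (\<Sum>s\<in>?I. f (a * s + b))"
    by (intro sum.cong refl periodicD[OF assms(2)]) simp
  finally show ?thesis by (rule sym)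
qed

lemma sum_residues_scale:
  fixes f :: "int \<Rightarrow> 'a::comm_monoid_add"
  assumes "r > 0" "periodic r f" "coprime a (int r)"
  shows "(\<Sum>s\<in>{0..<int r}. f (a * s)) = (\<Sum>s\<in>{0..<int r}. f s)"
  using sum_residues_affine[OF assms, of 0] by simp

lemma sum_residues_shift:
  fixes f :: "int \<Rightarrow> 'a::comm_monoid_add"
  assumes "r > 0" "periodic r f"
  shows "(\<Sum>s\<in>{0..<int r}. f (s + b)) = (\<Sum>s\<in>{0..<int r}. f s)"
  using sum_residues_affine[OF assms, of 1] by simp

lemma sum_residues_indicator:
  fixes a b :: "'a::comm_ring_1"
  assumes "r > 0"
  shows "(\<Sum>u\<in>{0..<int r}. if int r dvd u then a else b) = a + (of_nat r - 1) * b"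
proof -
  have "{0..<int r} = insert 0 {1..<int r}" using assms by auto
  moreover have "(\<Sum>u\<in>{1..<int r}. if int r dvd u then a else b) = (\<Sum>u\<in>{1..<int r}. b)"
    by (intro sum.cong refl) (auto dest: zdvd_imp_le)
  ultimately show ?thesis
    using assms by (simp add: nat_diff_distrib of_nat_diff)
qed

abbreviation unity_poly :: "nat \<Rightarrow> 'a::comm_ring_1 poly" where
  "unity_poly r \<equiv> monom 1 r - 1"

definition cyclic_monom :: "nat \<Rightarrow> 'a::comm_ring_1 \<Rightarrow> int \<Rightarrow> 'a poly" where
  "cyclic_monom r c u = monom c (nat (u mod int r))"

definition group_ring :: "nat \<Rightarrow> (int \<Rightarrow> 'a::comm_ring_1) \<Rightarrow> 'a poly" where
  "group_ring r f = (\<Sum>u\<in>{0..<int r}. cyclic_monom r (f u) u)"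

definition convolution :: "nat \<Rightarrow> (int \<Rightarrow> 'a::comm_ring_1) \<Rightarrow> (int \<Rightarrow> 'a) \<Rightarrow> int \<Rightarrow> 'a" where
  "convolution r f g u = (\<Sum>s\<in>{0..<int r}. f s * g (u - s))"

lemma periodic_cyclic_monom:
  assumes "periodic r f"
  shows "periodic r (\<lambda>u. cyclic_monom r (f u) u)"
proof (rule periodicI)
  fix a b assume "[a = b] (mod int r)"
  moreover from this have "f a = f b" by (rule periodicD[OF assms])
  ultimately show "cyclic_monom r (f a) a = cyclic_monom r (f b) b"
    by (simp add: cyclic_monom_def cong_def)
qed

lemma monom_cong2_mod: "[monom c n = monom c (n mod r)] (mod q, unity_poly r)"
proof -
  have "monom c n = monom c (n mod r + r * (n div r))" by simp
  also have "\<dots> = monom c (n mod r) * monom 1 r ^ (n div r)"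
    by (simp only: monom_power mult_monom power_one mult_1_right)
  also have "[\<dots> = monom c (n mod r) * 1 ^ (n div r)] (mod q, unity_poly r)"
    by (intro cong2_mult cong2_refl cong2_power cong2_of_dvd_right) simp
  finally show ?thesis by simp
qed

lemma cyclic_monom_mult:
  assumes "r > 0"
  shows "[cyclic_monom r a s * cyclic_monom r b t
    = cyclic_monom r (a * b) (s + t)] (mod q, unity_poly r)"
proof -
  define n where "n = nat (s mod int r) + nat (t mod int r)"
  have "int n = s mod int r + t mod int r" using assms by (simp add: n_def)
  then have "int (n mod r) = (s + t) mod int r" by (simp add: zmod_int mod_simps)
  then have "n mod r = nat ((s + t) mod int r)" by linarith
  then show ?thesis
    using monom_cong2_mod[of q r "a * b" n] by (simp add: cyclic_monom_def n_def mult_monom)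
qed

lemma cyclic_monom_power:
  assumes "r > 0"
  shows "[cyclic_monom r a s ^ n = cyclic_monom r (a ^ n) (int n * s)] (mod q, unity_poly r)"
proof (induction n)
  case (Suc n)
  have "[cyclic_monom r a s * cyclic_monom r a s ^ n
      = cyclic_monom r a s * cyclic_monom r (a ^ n) (int n * s)] (mod q, unity_poly r)"
    using Suc.IH by (rule cong2_scalar_left)
  also have "[\<dots> = cyclic_monom r (a * a ^ n) (s + int n * s)] (mod q, unity_poly r)"
    using assms by (rule cyclic_monom_mult)
  finally show ?case by (simp add: algebra_simps)
qed (simp add: cyclic_monom_def)

lemma coeff_group_ring: "coeff (group_ring r f) n = (if n < r then f (int n) else 0)"
proof -
  have "coeff (group_ring r f) n = (\<Sum>u\<in>{0..<int r}. if u = int n then f u else 0)"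
    unfolding group_ring_def coeff_sum by (rule sum.cong) (auto simp: cyclic_monom_def)
  also have "\<dots> = (if n < r then f (int n) else 0)"
    by (subst sum.delta) auto
  finally show ?thesis .
qed

lemma group_ring_smult: "group_ring r (\<lambda>u. c * f u) = [:c:] * group_ring r f"
  by (simp add: poly_eq_iff coeff_group_ring)

lemma group_ring_mult:
  assumes "r > 0" "periodic r g"
  shows "[group_ring r f * group_ring r g = group_ring r (convolution r f g)] (mod q, unity_poly r)"
proof -
  let ?I = "{0..<int r}"
  let ?term = "\<lambda>s u. cyclic_monom r (f s * g (u - s)) u"
  have "group_ring r f * group_ring r g
      = (\<Sum>s\<in>?I. \<Sum>t\<in>?I. cyclic_monom r (f s) s * cyclic_monom r (g t) t)"
    unfolding group_ring_def by (rule sum_product)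
  also have "[\<dots> = (\<Sum>s\<in>?I. \<Sum>t\<in>?I. cyclic_monom r (f s * g t) (s + t))] (mod q, unity_poly r)"
    by (intro cong2_sum cyclic_monom_mult assms(1))
  also have "\<dots> = (\<Sum>s\<in>?I. \<Sum>t\<in>?I. ?term s (t + s))" by (simp add: add.commute)
  also have "\<dots> = (\<Sum>s\<in>?I. \<Sum>u\<in>?I. ?term s u)"
  proof (rule sum.cong[OF refl])
    fix s
    have "periodic r (\<lambda>u. f s * g (u - s))"
    proof (rule periodicI)
      fix a b assume "[a = b] (mod int r)"
      then have "g (a - s) = g (b - s)" by (intro periodicD[OF assms(2)] cong_diff cong_refl)
      then show "f s * g (a - s) = f s * g (b - s)" by simp
    qed
    then show "(\<Sum>t\<in>?I. ?term s (t + s)) = (\<Sum>u\<in>?I. ?term s u)"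
      by (intro sum_residues_shift assms(1) periodic_cyclic_monom)
  qed
  also have "\<dots> = (\<Sum>u\<in>?I. \<Sum>s\<in>?I. ?term s u)" by (rule sum.swap)
  also have "\<dots> = group_ring r (convolution r f g)"
    by (simp add: group_ring_def convolution_def cyclic_monom_def monom_sum)
  finally show ?thesis .
qed

lemma frobenius_group_ring:
  fixes f :: "int \<Rightarrow> 'a::comm_ring_1"
  assumes "prime q" "r > 0" "periodic r f" and k: "[k * int (q ^ e) = 1] (mod int r)"
  shows "[group_ring r f ^ (q ^ e)
    = group_ring r (\<lambda>u. f (k * u) ^ (q ^ e))] (mod of_nat q, unity_poly r)"
proof -
  let ?I = "{0..<int r}" and ?Q = "q ^ e"
  let ?h = "\<lambda>u. cyclic_monom r (f (k * u) ^ ?Q) u"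
  have "[group_ring r f ^ ?Q = (\<Sum>u\<in>?I. cyclic_monom r (f u) u ^ ?Q)] (mod of_nat q, unity_poly r)"
    unfolding group_ring_def by (rule freshmans_dream_sum_power_cong2[OF assms(1)])
  also have "[\<dots> = (\<Sum>u\<in>?I. cyclic_monom r (f u ^ ?Q) (int ?Q * u))] (mod of_nat q, unity_poly r)"
    by (intro cong2_sum cyclic_monom_power assms(2))
  also have "\<dots> = (\<Sum>u\<in>?I. ?h (int ?Q * u))"
  proof (intro sum.cong refl)
    fix u
    have "[k * (int ?Q * u) = u] (mod int r)"
      using cong_scalar_right[OF k, of u] by (simp add: mult.assoc)
    then have "f (k * (int ?Q * u)) = f u" by (rule periodicD[OF assms(3)])
    then show "cyclic_monom r (f u ^ ?Q) (int ?Q * u) = ?h (int ?Q * u)" by simp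
  qed
  also have "\<dots> = (\<Sum>u\<in>?I. ?h u)"
  proof (intro sum_residues_scale assms(2) periodic_cyclic_monom periodicI)
    fix a b assume "[a = b] (mod int r)"
    then have "f (k * a) = f (k * b)" by (intro periodicD[OF assms(3)] cong_scalar_left)
    then show "f (k * a) ^ ?Q = f (k * b) ^ ?Q" by simp
  next
    show "coprime (int ?Q) (int r)" using k by (metis coprime_iff_invertible_int mult.commute)
  qed
  finally show ?thesis by (simp only: group_ring_def)
qed

lemma group_ring_cong_imp_dvd:
  fixes f g :: "int \<Rightarrow> 'a::idom"
  assumes cong: "[group_ring r f = group_ring r g] (mod of_nat q, unity_poly r)" and i: "i < r"
  shows "of_nat q dvd f (int i) - g (int i)"
proof -
  define F where "F = group_ring r f - group_ring r g"
  define P :: "'a poly" where "P = unity_poly r"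
  have deg_P: "degree P = r" and lead_P: "lead_coeff P = 1" and P_ne: "P \<noteq> 0"
  proof -
    have "degree (1 :: 'a poly) < degree (monom (1 :: 'a) r)" using i by (simp add: degree_monom_eq)
    then show "degree P = r"
      using degree_add_eq_left[of "- 1" "monom 1 r"] by (simp add: P_def degree_monom_eq)
    then show "lead_coeff P = 1" using i by (simp add: P_def)
    then show "P \<noteq> 0" by auto
  qed
  have deg_F: "degree F < r"
    using i by (intro le_less_trans[OF degree_le, of "r - 1"]) (auto simp: F_def coeff_group_ring)
  obtain u v where uv: "F = of_nat q * u + P * v"
    using cong unfolding F_def P_def by (rule cong2E)
  obtain w u' where "pseudo_divmod u P = (w, u')" by (rule prod.exhaust)
  note division = pseudo_divmod[OF P_ne this]
  have u: "u = P * w + u'" using division(1) by (simp add: lead_P)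
  have deg_u': "degree (of_nat q * u') < r"
    using division(2) deg_P i degree_mult_le[of "of_nat q" u'] by (auto simp: of_nat_poly)
  have F_eq: "F - of_nat q * u' = P * (of_nat q * w + v)" by (simp add: uv u algebra_simps)
  moreover have "degree (F - of_nat q * u') < r"
    using deg_F deg_u' by (rule degree_diff_less)
  ultimately have "of_nat q * w + v = 0"
    using P_ne deg_P degree_mult_eq[of P "of_nat q * w + v"] by (cases "of_nat q * w + v = 0") auto
  then have "F = of_nat q * u'" using F_eq by simp
  then have "coeff F i = of_nat q * coeff u' i" by (simp add: of_nat_poly)
  then show ?thesis using i by (simp add: F_def coeff_group_ring)
qed

section \<open>Cubic characters and their Jacobi sums\<close>

locale cubic_character =
  fixes n :: int and \<chi> :: "int \<Rightarrow> eis"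
  assumes chi_mult: "\<chi> (a * b) = \<chi> a * \<chi> b"
    and chi_cong: "[a = b] (mod n) \<Longrightarrow> \<chi> a = \<chi> b"
    and chi_cube: "coprime a n \<Longrightarrow> \<chi> a ^ 3 = 1"
begin

lemma chi_1: "\<chi> 1 = 1"
  using chi_cube[of 1] chi_mult[of 1 1] by (auto simp: power3_eq_cube)

lemma chi_minus_1: "\<chi> (- 1) = 1"
  using chi_cube[of "- 1"] chi_mult[of "- 1" "- 1"] by (simp add: power3_eq_cube chi_1)

lemma chi_minus: "\<chi> (- a) = \<chi> a"
  using chi_mult[of "- 1" a] by (simp add: chi_minus_1)

lemma chi_power: "\<chi> (a ^ k) = \<chi> a ^ k"
  by (induction k) (simp_all add: chi_1 chi_mult)

end

locale prime_cubic_character = cubic_character "int r" \<chi> for r :: nat and \<chi> :: "int \<Rightarrow> eis" +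
  assumes prime_r: "prime r"
    and chi_dvd: "int r dvd a \<Longrightarrow> \<chi> a = 0"
    and chi_nontrivial: "\<exists>a. coprime a (int r) \<and> \<chi> a \<noteq> 1"
begin

lemma r_gt_1: "r > 1" and r_pos: "r > 0"
  using prime_gt_1_nat[OF prime_r] by simp_all

lemma coprime_if_not_dvd: "\<not> int r dvd a \<Longrightarrow> coprime a (int r)"
  using prime_r prime_imp_coprime[of "int r" a] by (simp add: coprime_commute)

lemma econj_chi: "econj (\<chi> a) = \<chi> a ^ 2"
  using chi_dvd[of a] chi_cube[of a] coprime_if_not_dvd[of a] econj_cube_root_of_unity[of "\<chi> a"]
  by (cases "int r dvd a") simp_all

lemma periodic_chi: "periodic r \<chi>"
  by (rule periodicI) (rule chi_cong)

lemma periodic_chi_square: "periodic r (\<lambda>s. (\<chi> s)\<^sup>2)"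
  by (rule periodicI) (simp only: chi_cong)

lemma sum_chi: "(\<Sum>s\<in>{0..<int r}. \<chi> s) = 0"
proof -
  obtain a where a: "coprime a (int r)" "\<chi> a \<noteq> 1" using chi_nontrivial by blast
  have "(\<Sum>s\<in>{0..<int r}. \<chi> s) = (\<Sum>s\<in>{0..<int r}. \<chi> (a * s))"
    using sum_residues_scale[OF r_pos periodic_chi a(1)] by (rule sym)
  also have "\<dots> = \<chi> a * (\<Sum>s\<in>{0..<int r}. \<chi> s)" by (simp add: chi_mult sum_distrib_left)
  finally show ?thesis using a(2) by (metis mult_cancel_right1)
qed

lemma sum_chi_square: "(\<Sum>s\<in>{0..<int r}. (\<chi> s)\<^sup>2) = 0"
proof -
  have "(\<Sum>s\<in>{0..<int r}. (\<chi> s)\<^sup>2) = econj (\<Sum>s\<in>{0..<int r}. \<chi> s)" by (simp add: econj_chi)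
  then show ?thesis by (simp add: sum_chi)
qed

lemma chi_reflect: "int r dvd u \<Longrightarrow> \<chi> (u - s) = \<chi> s"
  using chi_cong[of "u - s" "- s"] by (simp add: cong_iff_dvd_diff chi_minus)

lemma convolution_chi_powers:
  assumes "coprime u (int r)"
  shows "convolution r (\<lambda>s. \<chi> s ^ k) (\<lambda>s. \<chi> s ^ l) u
    = \<chi> u ^ (k + l) * (\<Sum>s\<in>{0..<int r}. \<chi> s ^ k * \<chi> (1 - s) ^ l)"
proof -
  let ?f = "\<lambda>s. \<chi> s ^ k * \<chi> (u - s) ^ l"
  have "periodic r ?f"
  proof (rule periodicI)
    fix a b assume "[a = b] (mod int r)"
    then have "\<chi> a = \<chi> b" "\<chi> (u - a) = \<chi> (u - b)" by (auto intro!: chi_cong cong_diff)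
    then show "?f a = ?f b" by simp
  qed
  then have "convolution r (\<lambda>s. \<chi> s ^ k) (\<lambda>s. \<chi> s ^ l) u = (\<Sum>s\<in>{0..<int r}. ?f (u * s))"
    unfolding convolution_def using sum_residues_scale[OF r_pos _ assms, of ?f] by simp
  moreover have "?f (u * s) = \<chi> u ^ (k + l) * (\<chi> s ^ k * \<chi> (1 - s) ^ l)" for s
    using chi_mult[of u "1 - s"]
    by (simp add: right_diff_distrib chi_mult power_mult_distrib power_add)
  ultimately show ?thesis by (simp add: sum_distrib_left)
qed

definition jacobi_sum :: eis where
  "jacobi_sum = (\<Sum>s\<in>{0..<int r}. \<chi> s * \<chi> (1 - s))"

lemma convolution_chi_chi: "convolution r \<chi> \<chi> u = jacobi_sum * (\<chi> u)\<^sup>2"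
proof (cases "int r dvd u")
  case True
  then have "convolution r \<chi> \<chi> u = (\<Sum>s\<in>{0..<int r}. (\<chi> s)\<^sup>2)"
    by (simp add: convolution_def chi_reflect power2_eq_square)
  then show ?thesis using True by (simp add: sum_chi_square chi_dvd)
next
  case False
  then show ?thesis
    using convolution_chi_powers[OF coprime_if_not_dvd, of u 1 1]
    by (simp add: jacobi_sum_def power2_eq_square mult.commute)
qed

lemma convolution_chi_square_chi_square:
  "convolution r (\<lambda>s. (\<chi> s)\<^sup>2) (\<lambda>s. (\<chi> s)\<^sup>2) u = econj jacobi_sum * \<chi> u"
proof -
  have "convolution r (\<lambda>s. (\<chi> s)\<^sup>2) (\<lambda>s. (\<chi> s)\<^sup>2) u = econj (convolution r \<chi> \<chi> u)"
    by (simp add: convolution_def econj_chi)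
  also have "\<dots> = econj (jacobi_sum * econj (\<chi> u))"
    by (simp only: convolution_chi_chi econj_chi)
  finally show ?thesis by simp
qed

lemma sum_convolution_chi_chi_square:
  "(\<Sum>u\<in>{0..<int r}. convolution r \<chi> (\<lambda>s. (\<chi> s)\<^sup>2) u) = 0"
proof -
  let ?I = "{0..<int r}"
  have "(\<Sum>u\<in>?I. convolution r \<chi> (\<lambda>s. (\<chi> s)\<^sup>2) u) = (\<Sum>s\<in>?I. \<chi> s * (\<Sum>u\<in>?I. (\<chi> (u - s))\<^sup>2))"
    unfolding convolution_def by (subst sum.swap) (simp add: sum_distrib_left)
  moreover have "(\<Sum>u\<in>?I. (\<chi> (u - s))\<^sup>2) = 0" for s
    using sum_residues_shift[OF r_pos periodic_chi_square, of "- s"] by (simp add: sum_chi_square)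
  ultimately show ?thesis by simp
qed

text \<open>The coefficients of \<open>r\<close> times the projection onto the augmentation ideal.\<close>

definition augmentation_coeff :: "int \<Rightarrow> eis" where
  "augmentation_coeff u = (if int r dvd u then of_nat r else 0) - 1"

lemma convolution_chi_chi_square:
  "convolution r \<chi> (\<lambda>s. (\<chi> s)\<^sup>2) u = augmentation_coeff u"
proof -
  define K where "K = (\<Sum>s\<in>{0..<int r}. \<chi> s * (\<chi> (1 - s))\<^sup>2)"
  have conv: "convolution r \<chi> (\<lambda>s. (\<chi> s)\<^sup>2) u = (if int r dvd u then of_nat r - 1 else K)" for u
  proof (cases "int r dvd u")
    case True
    then have "convolution r \<chi> (\<lambda>s. (\<chi> s)\<^sup>2) u = (\<Sum>s\<in>{0..<int r}. \<chi> s ^ 3)"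
      by (simp add: convolution_def chi_reflect power2_eq_square power3_eq_cube mult.assoc)
    also have "\<dots> = (\<Sum>s\<in>{0..<int r}. if int r dvd s then 0 else 1)"
      by (intro sum.cong refl) (simp add: chi_dvd chi_cube coprime_if_not_dvd)
    finally show ?thesis using True by (simp add: sum_residues_indicator[OF r_pos])
  next
    case False
    then show ?thesis
      using convolution_chi_powers[OF coprime_if_not_dvd[OF False], of 1 2]
        chi_cube[OF coprime_if_not_dvd[OF False]]
      by (simp add: K_def numeral_3_eq_3)
  qed
  have "(of_nat r - 1) * (1 + K) = 0"
    using sum_convolution_chi_chi_square
    by (simp add: conv sum_residues_indicator[OF r_pos] algebra_simps)
  moreover have "(of_nat r - 1 :: eis) \<noteq> 0" using r_gt_1 by (simp add: of_nat_eq_1_iff)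
  ultimately have "K = - 1" by (simp add: add_eq_0_iff)
  then show ?thesis by (simp add: conv augmentation_coeff_def)
qed

abbreviation gauss_sum :: "eis poly" where
  "gauss_sum \<equiv> group_ring r \<chi>"

abbreviation gauss_sum_square :: "eis poly" where
  "gauss_sum_square \<equiv> group_ring r (\<lambda>s. (\<chi> s)\<^sup>2)"

abbreviation augmentation :: "eis poly" where
  "augmentation \<equiv> group_ring r augmentation_coeff"

lemma gauss_sum_mult_self:
  "[gauss_sum * gauss_sum = [:jacobi_sum:] * gauss_sum_square] (mod q, unity_poly r)"
  using group_ring_mult[OF r_pos periodic_chi, of q \<chi>]
  by (simp only: convolution_chi_chi[abs_def] group_ring_smult)

lemma gauss_sum_square_mult_self:
  "[gauss_sum_square * gauss_sum_square = [:econj jacobi_sum:] * gauss_sum] (mod q, unity_poly r)"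
  using group_ring_mult[OF r_pos periodic_chi_square, of q "\<lambda>s. (\<chi> s)\<^sup>2"]
  by (simp only: convolution_chi_square_chi_square[abs_def] group_ring_smult)

lemma gauss_sum_mult_gauss_sum_square:
  "[gauss_sum * gauss_sum_square = augmentation] (mod q, unity_poly r)"
  using group_ring_mult[OF r_pos periodic_chi_square, of q \<chi>]
  by (simp only: convolution_chi_chi_square[abs_def])

lemma augmentation_mult_gauss_sum:
  "[augmentation * gauss_sum = [:of_nat r:] * gauss_sum] (mod q, unity_poly r)"
proof -
  let ?I = "{0..<int r}"
  have "convolution r augmentation_coeff \<chi> = (\<lambda>u. of_nat r * \<chi> u)"
  proof (rule ext)
    fix u
    have "convolution r augmentation_coeff \<chi> u
        = (\<Sum>s\<in>?I. if int r dvd s then of_nat r * \<chi> (u - s) else 0) - (\<Sum>s\<in>?I. \<chi> (u - s))"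
      unfolding convolution_def augmentation_coeff_def sum_subtractf[symmetric]
      by (intro sum.cong refl) (simp add: algebra_simps)
    also have "(\<Sum>s\<in>?I. if int r dvd s then of_nat r * \<chi> (u - s) else 0)
        = (\<Sum>s\<in>?I. if int r dvd s then of_nat r * \<chi> u else 0)"
      by (intro sum.cong refl) (auto intro: chi_cong simp: cong_iff_dvd_diff)
    also have "(\<Sum>s\<in>?I. \<chi> (u - s)) = (\<Sum>s\<in>?I. \<chi> s)"
      using sum_residues_affine[OF r_pos periodic_chi, of "- 1" u] by simp
    finally show "convolution r augmentation_coeff \<chi> u = of_nat r * \<chi> u"
      by (simp add: sum_chi sum_residues_indicator[OF r_pos])
  qed
  then show ?thesis
    using group_ring_mult[OF r_pos periodic_chi, of q augmentation_coeff]
    by (simp only: group_ring_smult)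
qed

lemma gauss_sum_cube: "[gauss_sum ^ 3 = [:jacobi_sum:] * augmentation] (mod q, unity_poly r)"
proof -
  have "gauss_sum ^ 3 = gauss_sum * gauss_sum * gauss_sum" by (simp add: power3_eq_cube)
  also have "[\<dots> = [:jacobi_sum:] * gauss_sum_square * gauss_sum] (mod q, unity_poly r)"
    by (intro cong2_mult cong2_refl gauss_sum_mult_self)
  also have "\<dots> = [:jacobi_sum:] * (gauss_sum * gauss_sum_square)" by (simp only: mult_ac)
  also have "[\<dots> = [:jacobi_sum:] * augmentation] (mod q, unity_poly r)"
    by (intro cong2_scalar_left gauss_sum_mult_gauss_sum_square)
  finally show ?thesis .
qed

lemma gauss_sum_power_Suc_triple:
  "[gauss_sum ^ Suc (3 * m) = [:(of_nat r * jacobi_sum) ^ m:] * gauss_sum] (mod q, unity_poly r)"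
proof (induction m)
  case (Suc m)
  let ?c = "(of_nat r * jacobi_sum) ^ m"
  have "gauss_sum ^ Suc (3 * Suc m) = gauss_sum ^ 3 * gauss_sum ^ Suc (3 * m)"
    by (simp only: power_add[symmetric]) simp
  also have "[\<dots> = ([:jacobi_sum:] * augmentation) * ([:?c:] * gauss_sum)] (mod q, unity_poly r)"
    by (intro cong2_mult gauss_sum_cube Suc.IH)
  also have "\<dots> = [:jacobi_sum * ?c:] * (augmentation * gauss_sum)" by (simp add: mult.commute)
  also have "[\<dots> = [:jacobi_sum * ?c:] * ([:of_nat r:] * gauss_sum)] (mod q, unity_poly r)"
    by (intro cong2_scalar_left augmentation_mult_gauss_sum)
  also have "\<dots> = [:(of_nat r * jacobi_sum) ^ Suc m:] * gauss_sum" by (simp add: mult_ac)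
  finally show ?case .
qed (simp flip: one_pCons)

lemma enorm_jacobi_sum: "enorm jacobi_sum = int r"
proof -
  let ?J = jacobi_sum
  have "gauss_sum * (gauss_sum * gauss_sum_square) = gauss_sum * gauss_sum * gauss_sum_square"
    by (simp only: mult.assoc)
  also have "[\<dots> = [:?J:] * gauss_sum_square * gauss_sum_square] (mod of_nat 0, unity_poly r)"
    by (intro cong2_mult cong2_refl gauss_sum_mult_self)
  also have "\<dots> = [:?J:] * (gauss_sum_square * gauss_sum_square)" by (simp only: mult.assoc)
  also have "[\<dots> = [:?J:] * ([:econj ?J:] * gauss_sum)] (mod of_nat 0, unity_poly r)"
    by (intro cong2_scalar_left gauss_sum_square_mult_self)
  also have "\<dots> = group_ring r (\<lambda>u. of_int (enorm ?J) * \<chi> u)"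
    unfolding group_ring_smult by (simp add: mult.commute flip: mult_econj)
  finally have "[group_ring r (\<lambda>u. of_int (enorm ?J) * \<chi> u)
      = gauss_sum * (gauss_sum * gauss_sum_square)] (mod of_nat 0, unity_poly r)"
    by (rule cong2_sym)
  also have "[\<dots> = gauss_sum * augmentation] (mod of_nat 0, unity_poly r)"
    by (intro cong2_scalar_left gauss_sum_mult_gauss_sum_square)
  also have "gauss_sum * augmentation = augmentation * gauss_sum" by (rule mult.commute)
  also have "[\<dots> = [:of_nat r:] * gauss_sum] (mod of_nat 0, unity_poly r)"
    by (rule augmentation_mult_gauss_sum)
  also have "\<dots> = group_ring r (\<lambda>u. of_nat r * \<chi> u)" by (rule group_ring_smult[symmetric])
  finally have "of_nat 0 dvd of_int (enorm ?J) * \<chi> (int 1) - of_nat r * \<chi> (int 1)"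
    using r_gt_1 by (rule group_ring_cong_imp_dvd)
  then have "of_int (enorm ?J) = (of_int (int r) :: eis)" by (simp add: chi_1)
  then show ?thesis by (simp only: of_int_eq_iff)
qed

lemma frobenius_gauss_sum:
  assumes "prime q" "q \<noteq> r"
  obtains k where "[k * int (q ^ e) = 1] (mod int r)"
    "[gauss_sum ^ (q ^ e) = group_ring r (\<lambda>u. \<chi> (k * u) ^ (q ^ e))] (mod of_nat q, unity_poly r)"
proof -
  have "coprime (int (q ^ e)) (int r)"
    using assms prime_r by (simp add: primes_coprime)
  then obtain k where "[int (q ^ e) * k = 1] (mod int r)" using cong_solve_coprime_int by blast
  then have k: "[k * int (q ^ e) = 1] (mod int r)" by (simp only: mult.commute)
  show ?thesis
    using that[OF k] frobenius_group_ring[OF assms(1) r_pos periodic_chi k] by blast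
qed

lemma three_dvd_jacobi_sum_plus_1:
  assumes "r \<noteq> 3"
  shows "3 dvd jacobi_sum + 1"
proof -
  obtain k where k: "[k * int (3 ^ 1) = 1] (mod int r)"
    "[gauss_sum ^ (3 ^ 1) = group_ring r (\<lambda>u. \<chi> (k * u) ^ (3 ^ 1))] (mod of_nat 3, unity_poly r)"
    by (rule frobenius_gauss_sum[of 3 1]) (use assms in simp_all)
  have "[group_ring r (\<lambda>u. jacobi_sum * augmentation_coeff u)
      = gauss_sum ^ 3] (mod of_nat 3, unity_poly r)"
    unfolding group_ring_smult by (rule cong2_sym[OF gauss_sum_cube])
  also have "[\<dots> = group_ring r (\<lambda>u. \<chi> (k * u) ^ 3)] (mod of_nat 3, unity_poly r)"
    using k(2) by simp
  finally have "of_nat 3 dvd jacobi_sum * augmentation_coeff (int 1) - \<chi> (k * int 1) ^ 3"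
    using r_gt_1 by (rule group_ring_cong_imp_dvd)
  moreover have "\<chi> k ^ 3 = 1" using k(1) by (intro chi_cube) (metis coprime_iff_invertible_int)
  ultimately have "3 dvd - (jacobi_sum + 1)" using r_gt_1 by (simp add: augmentation_coeff_def)
  then show ?thesis by (simp only: dvd_minus_iff)
qed

end

section \<open>Cubic reciprocity for rational primes\<close>

definition cubic_exponent :: "nat \<Rightarrow> nat" where
  "cubic_exponent q = (q\<^sup>2 - 1) div 3"

text \<open>
  The power below is congruent modulo a prime \<open>q\<close> to the cubic residue symbol of \<open>A\<close> modulo \<open>q\<close>:
  the factor \<open>N(A)\<close> makes one formula serve the split and the inert primes \<open>q\<close>.
\<close>

definition cubic_power :: "nat \<Rightarrow> eis \<Rightarrow> eis" where
  "cubic_power q A = (A * of_int (enorm A)) ^ cubic_exponent q"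

lemma prime_square_eq_Suc:
  assumes "prime q" "q \<noteq> 3"
  shows "q\<^sup>2 = Suc (3 * cubic_exponent q)"
proof -
  have "q\<^sup>2 mod 3 = (q mod 3)\<^sup>2 mod 3" by (simp add: power_mod)
  then have "q\<^sup>2 mod 3 = 1" using prime_mod_3[OF assms] by auto
  then show ?thesis unfolding cubic_exponent_def by presburger
qed

lemma cubic_power_mult: "cubic_power q (A * B) = cubic_power q A * cubic_power q B"
  by (simp add: cubic_power_def power_mult_distrib mult_ac)

lemma cubic_power_econj: "cubic_power q (econj A) = econj (cubic_power q A)"
  by (simp add: cubic_power_def)

lemma cubic_power_cong:
  assumes "[A \<equiv> B] (mod q)"
  shows "[cubic_power q A \<equiv> cubic_power q B] (mod q)"
  unfolding cubic_power_def mult_econj[symmetric]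
  by (intro cong2_power cong2_mult eis_cong_econj assms)

lemma cubic_power_cong_1:
  assumes "prime q" "q \<noteq> 3" "A * of_int (enorm A) = C ^ 3" "\<not> int q dvd enorm C"
  shows "[cubic_power q A \<equiv> 1] (mod q)"
proof -
  have "cubic_power q A = C ^ (q\<^sup>2 - 1)"
    by (simp add: cubic_power_def assms(3) prime_square_eq_Suc[OF assms(1,2)] flip: power_mult)
  then show ?thesis using fermat_eis[OF assms(1,2,4)] by simp
qed

lemma cubic_power_of_int_cong:
  assumes "prime q" "q \<noteq> 3" "\<not> int q dvd c"
  shows "[cubic_power q (of_int c) \<equiv> 1] (mod q)"
proof (rule cubic_power_cong_1[OF assms(1,2)])
  show "of_int c * of_int (enorm (of_int c)) = (of_int c :: eis) ^ 3"
    by (simp add: power2_eq_square power3_eq_cube)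
  show "\<not> int q dvd enorm (of_int c)"
    using assms(1,3) prime_dvd_power[of "int q" c 2] by auto
qed

lemma cubic_power_theta_cong:
  assumes "prime q" "q \<noteq> 3"
  shows "[cubic_power q \<theta> \<equiv> 1] (mod q)"
proof (rule cubic_power_cong_1[OF assms])
  show "\<theta> * of_int (enorm \<theta>) = (- \<theta>) ^ 3"
    by (rule eis_eqI) (simp_all add: power3_eq_cube)
  show "\<not> int q dvd enorm (- \<theta>)"
    using assms primes_dvd_imp_eq[of q 3] int_dvd_int_iff[of q 3] by auto
qed

lemma (in prime_cubic_character) cubic_power_jacobi_sum_cong:
  assumes "prime q" "q \<noteq> 3" "q \<noteq> r"
  shows "[cubic_power q jacobi_sum \<equiv> \<chi> (int q)] (mod q)"
proof -
  let ?c = "(of_nat r * jacobi_sum) ^ cubic_exponent q"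
  note square = prime_square_eq_Suc[OF assms(1,2)]
  obtain k where k: "[k * int (q\<^sup>2) = 1] (mod int r)"
    and frob: "[gauss_sum ^ q\<^sup>2 = group_ring r (\<lambda>u. \<chi> (k * u) ^ q\<^sup>2)] (mod of_nat q, unity_poly r)"
    using frobenius_gauss_sum[OF assms(1,3), of 2] .
  have "[group_ring r (\<lambda>u. ?c * \<chi> u) = gauss_sum ^ q\<^sup>2] (mod of_nat q, unity_poly r)"
    unfolding group_ring_smult square by (rule cong2_sym[OF gauss_sum_power_Suc_triple])
  also note frob
  finally have "of_nat q dvd ?c * \<chi> (int 1) - \<chi> (k * int 1) ^ q\<^sup>2"
    using r_gt_1 by (rule group_ring_cong_imp_dvd)
  then have "[cubic_power q jacobi_sum \<equiv> \<chi> k ^ q\<^sup>2] (mod q)"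
    by (simp add: cubic_power_def enorm_jacobi_sum chi_1 cong2_0_iff mult.commute)
  also have "\<chi> k ^ q\<^sup>2 = \<chi> (int q)"
  proof -
    have "coprime k (int r)" using k by (metis coprime_iff_invertible_int)
    then have k_power: "\<chi> k ^ q\<^sup>2 = \<chi> k" by (simp add: square power_mult chi_cube)
    have "\<chi> k * \<chi> (int q) ^ 2 = 1"
      using chi_cong[OF k] by (simp add: chi_mult chi_power chi_1)
    then have "\<chi> k * \<chi> (int q) ^ 3 = \<chi> (int q)"
      by (metis mult.assoc mult_1 numeral_3_eq_3 numeral_2_eq_2 power_Suc2)
    moreover have "coprime (int q) (int r)" using assms(1,3) prime_r by (simp add: primes_coprime)
    ultimately show ?thesis using k_power by (simp add: chi_cube)
  qed
  finally show ?thesis .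
qed

context
  fixes r g :: nat
  assumes r: "prime r" "[r = 1] (mod 3)" and g: "residue_primroot r g"
begin

lemma primroot_power_cong_exists:
  assumes "coprime a (int r)"
  shows "\<exists>i. [a = int g ^ i] (mod int r)"
proof -
  define b where "b = nat (a mod int r)"
  have r_gt_1: "r > 1" using r(1) by (rule prime_gt_1_nat)
  then have b: "int b = a mod int r" by (simp add: b_def)
  have "b \<in> totatives r"
  proof -
    have "coprime (int b) (int r)"
      using assms r_gt_1
      unfolding b by (simp add: coprime_iff_gcd_eq_1 gcd.commute flip: gcd_red_int)
    moreover have "b < r" using r_gt_1 by (simp add: b_def nat_less_iff)
    moreover have "b \<noteq> 0" using calculation(1) r_gt_1 by (intro notI) simp
    ultimately show ?thesis by (simp add: totatives_def)
  qed
  then obtain i where "b = g ^ i mod r"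
    using residue_primroot_is_generator[OF r_gt_1 g] by (auto simp: bij_betw_def)
  then have "[a = int g ^ i] (mod int r)" using b by (simp add: cong_def zmod_int)
  then show ?thesis by blast
qed

lemma omega_power_eq_if_primroot_power_cong:
  assumes "[int g ^ i = int g ^ j] (mod int r)"
  shows "\<omega> ^ i = \<omega> ^ j"
proof -
  have ord: "ord r g = r - 1" "coprime r g"
    using g r(1) by (auto simp: residue_primroot_def totient_prime)
  have "[g ^ i = g ^ j] (mod r)" using assms by (simp flip: cong_int_iff)
  then have "[i = j] (mod (r - 1))" using order_divides_expdiff[OF ord(2), of i j] ord(1) by simp
  moreover have "3 dvd r - 1" using r prime_gt_0_nat[of r] cong_to_1_nat by blast
  ultimately have "[i = j] (mod 3)" by (rule cong_dvd_modulus_nat)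
  then show ?thesis using omega_power_mod[of i] omega_power_mod[of j] by (simp add: cong_def)
qed

definition primroot_character :: "int \<Rightarrow> eis" where
  "primroot_character a =
    (if coprime a (int r) then \<omega> ^ (SOME i. [a = int g ^ i] (mod int r)) else 0)"

lemma primroot_character_power:
  assumes "[a = int g ^ i] (mod int r)"
  shows "primroot_character a = \<omega> ^ i"
proof -
  let ?j = "SOME i. [a = int g ^ i] (mod int r)"
  have "coprime (int g) (int r)" using g by (simp add: residue_primroot_def coprime_commute)
  then have coprime: "coprime a (int r)"
    using cong_imp_coprime[OF cong_sym[OF assms]] by simp
  have "[a = int g ^ ?j] (mod int r)" using assms by (rule someI)
  then have "[int g ^ ?j = int g ^ i] (mod int r)" using assms cong_sym cong_trans by blast
  then show ?thesis
    using coprime omega_power_eq_if_primroot_power_cong by (simp add: primroot_character_def)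
qed

lemma prime_cubic_character_primroot_character: "prime_cubic_character r primroot_character"
proof
  fix a b
  show "primroot_character (a * b) = primroot_character a * primroot_character b"
  proof (cases "coprime a (int r) \<and> coprime b (int r)")
    case True
    then obtain i j where ij: "[a = int g ^ i] (mod int r)" "[b = int g ^ j] (mod int r)"
      using primroot_power_cong_exists by meson
    then have "[a * b = int g ^ (i + j)] (mod int r)" unfolding power_add by (rule cong_mult)
    then have "primroot_character (a * b) = \<omega> ^ (i + j)" by (rule primroot_character_power)
    also have "\<dots> = primroot_character a * primroot_character b"
      using ij[THEN primroot_character_power] by (simp add: power_add)
    finally show ?thesis .
  qed (auto simp: primroot_character_def)
next
  fix a b assume "[a = b] (mod int r)"
  moreover from this have "[a = c] (mod int r) \<longleftrightarrow> [b = c] (mod int r)" for c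
    by (auto intro: cong_trans cong_sym)
  moreover from calculation have "coprime a (int r) \<longleftrightarrow> coprime b (int r)"
    by (meson cong_imp_coprime cong_sym)
  ultimately show "primroot_character a = primroot_character b"
    by (simp add: primroot_character_def)
next
  fix a assume "coprime a (int r)"
  then show "primroot_character a ^ 3 = 1"
    by (simp add: primroot_character_def)
next
  fix a assume "int r dvd a"
  then show "primroot_character a = 0"
    using prime_gt_1_nat[OF r(1)] coprime_absorb_right[of "int r" a]
    by (auto simp: primroot_character_def)
next
  have "primroot_character (int g) = \<omega>" using primroot_character_power[of "int g" 1] by simp
  moreover have "\<omega> \<noteq> 1" by (metis omega_sel(1) eis_sel(3) zero_neq_one)
  moreover have "coprime (int g) (int r)"
    using g by (simp add: residue_primroot_def coprime_commute)
  ultimately show "\<exists>a. coprime a (int r) \<and> primroot_character a \<noteq> 1" by metis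
qed (fact r(1))

end

lemma prime_cubic_character_exists:
  assumes "prime r" "[r = 1] (mod 3)"
  obtains \<chi> where "prime_cubic_character r \<chi>"
proof -
  obtain g where "residue_primroot r g"
    using prime_primitive_root_exists[OF prime_gt_1_nat assms(1)] assms(1) by blast
  then show ?thesis using prime_cubic_character_primroot_character[OF assms] that by blast
qed

locale cubic_reciprocity = cubic_character "enorm A" \<chi> for A :: eis and \<chi> :: "int \<Rightarrow> eis" +
  assumes reciprocity:
    "prime q \<Longrightarrow> q \<noteq> 3 \<Longrightarrow> \<not> int q dvd enorm A \<Longrightarrow> [cubic_power q A \<equiv> \<chi> (int q)] (mod q)"

lemma cubic_reciprocity_mult:
  assumes "cubic_reciprocity A \<chi>" "cubic_reciprocity B \<psi>"
  shows "cubic_reciprocity (A * B) (\<lambda>a. \<chi> a * \<psi> a)"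
proof -
  interpret A: cubic_reciprocity A \<chi> by fact
  interpret B: cubic_reciprocity B \<psi> by fact
  show ?thesis
  proof
    fix a b assume "[a = b] (mod enorm (A * B))"
    then have "[a = b] (mod enorm A)" "[a = b] (mod enorm B)" by (auto intro: cong_dvd_modulus)
    then show "\<chi> a * \<psi> a = \<chi> b * \<psi> b" using A.chi_cong B.chi_cong by metis
  next
    fix q assume "prime q" "q \<noteq> 3" "\<not> int q dvd enorm (A * B)"
    then show "[cubic_power q (A * B) \<equiv> \<chi> (int q) * \<psi> (int q)] (mod q)"
      unfolding cubic_power_mult
      by (intro cong2_mult A.reciprocity B.reciprocity) auto
  qed (simp_all add: A.chi_mult B.chi_mult A.chi_cube B.chi_cube power_mult_distrib mult_ac)
qed

lemma cubic_reciprocity_econj: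
  assumes "cubic_reciprocity A \<chi>"
  shows "cubic_reciprocity (econj A) (\<lambda>a. econj (\<chi> a))"
proof -
  interpret cubic_reciprocity A \<chi> by fact
  show ?thesis
  proof
    fix a b assume "[a = b] (mod enorm (econj A))"
    then show "econj (\<chi> a) = econj (\<chi> b)" using chi_cong by simp
  next
    fix q assume "prime q" "q \<noteq> 3" "\<not> int q dvd enorm (econj A)"
    then show "[cubic_power q (econj A) \<equiv> econj (\<chi> (int q))] (mod q)"
      unfolding cubic_power_econj by (intro eis_cong_econj reciprocity) simp_all
  qed (simp_all add: chi_mult chi_cube flip: econj_power)
qed

lemma cubic_reciprocity_of_int: "cubic_reciprocity (of_int c) (\<lambda>_. 1)"
proof
  fix q assume "prime q" "q \<noteq> 3" "\<not> int q dvd enorm (of_int c)"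
  moreover from this have "\<not> int q dvd c" by (auto simp: power2_eq_square)
  ultimately show "[cubic_power q (of_int c) \<equiv> 1] (mod q)" by (intro cubic_power_of_int_cong)
qed simp_all

lemma (in prime_cubic_character) cubic_reciprocity_jacobi_sum: "cubic_reciprocity jacobi_sum \<chi>"
proof
  fix q assume "prime q" "q \<noteq> 3" "\<not> int q dvd enorm jacobi_sum"
  then show "[cubic_power q jacobi_sum \<equiv> \<chi> (int q)] (mod q)"
    by (intro cubic_power_jacobi_sum_cong) (auto simp: enorm_jacobi_sum)
qed (simp_all add: enorm_jacobi_sum chi_mult chi_cong chi_cube)

definition primary :: "eis \<Rightarrow> bool" where
  "primary A \<longleftrightarrow> 3 dvd om A \<and> \<not> 3 dvd re A"

lemma not_three_dvd_enorm_primary: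
  assumes "primary A"
  shows "\<not> 3 dvd enorm A"
proof
  assume "3 dvd enorm A"
  moreover have "3 dvd om A * (om A - re A)" using assms by (simp add: primary_def)
  ultimately have "3 dvd enorm A - om A * (om A - re A)" by (rule dvd_diff)
  then have "3 dvd (re A)\<^sup>2" by (simp add: enorm_def algebra_simps power2_eq_square)
  then show False using assms prime_dvd_power[of "3 :: int"] by (auto simp: primary_def)
qed

lemma primary_cofactor:
  assumes "primary (A * B)" "primary A"
  shows "primary B"
proof -
  have "3 dvd om (A * B) - om A * (re B - om B)"
    using assms by (intro dvd_diff dvd_mult2) (simp_all add: primary_def)
  also have "om (A * B) - om A * (re B - om B) = re A * om B" by (simp add: algebra_simps)
  finally have "3 dvd re A * om B" .
  then have "3 dvd om B" using assms(2) by (simp add: primary_def prime_dvd_mult_iff)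
  moreover have "\<not> 3 dvd re B"
  proof
    assume "3 dvd re B"
    then have "3 dvd re (A * B)" using \<open>3 dvd om B\<close> by simp
    then show False using assms(1) by (simp add: primary_def)
  qed
  ultimately show ?thesis by (simp add: primary_def)
qed

lemma econj_dvd_if_prime_dvd_om_mult:
  assumes "prime (enorm K)" "enorm K dvd om (A * K)"
  shows "econj K dvd A"
proof -
  let ?r = "enorm K" and ?x = "re (A * K)" and ?y = "om (A * K)"
  have "?r dvd enorm (A * K) - ?y * (?y - ?x)"
    using assms(2) by (intro dvd_diff dvd_mult2) simp_all
  then have "?r dvd ?x\<^sup>2"
    by (simp add: enorm_def power2_eq_square algebra_simps del: enorm_simps eis_sel)
  then have "?r dvd ?x" using assms(1) prime_dvd_power by blast
  then have "of_int ?r dvd A * K" using assms(2) unfolding of_int_dvd_eis_iff by blast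
  then have "K * econj K dvd K * A" by (simp add: mult_econj mult.commute)
  moreover have "K \<noteq> 0" using assms(1) by (auto simp: enorm_def)
  ultimately show ?thesis by (simp only: dvd_mult_cancel_left simp_thms)
qed

lemma dvd_or_econj_dvd:
  assumes "prime (enorm K)" "enorm K dvd enorm A"
  shows "K dvd A \<or> econj K dvd A"
proof -
  have "om (A * econj K) * om (A * K) = (om A)\<^sup>2 * enorm K - (om K)\<^sup>2 * enorm A"
    by (simp add: enorm_def power2_eq_square algebra_simps)
  then have "enorm K dvd om (A * econj K) * om (A * K)" using assms(2) by simp
  then consider "enorm K dvd om (A * K)" | "enorm (econj K) dvd om (A * econj K)"
    using assms(1) by (auto simp only: prime_dvd_mult_iff enorm_simps)
  then show ?thesis
    using econj_dvd_if_prime_dvd_om_mult[of K A] econj_dvd_if_prime_dvd_om_mult[of "econj K" A]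
    assms(1)
    by cases simp_all
qed

lemma primary_reciprocity_factor_exists:
  assumes "prime r" "r \<noteq> 3" "int r dvd enorm A"
  obtains K \<chi> where "cubic_reciprocity K \<chi>" "primary K" "K dvd A" "int r dvd enorm K"
proof (cases "of_nat r dvd A")
  case True
  moreover have "primary (of_nat r)"
    using assms(1,2) primes_dvd_imp_eq[of 3 r] int_dvd_int_iff[of 3 r] by (auto simp: primary_def)
  ultimately show ?thesis using that cubic_reciprocity_of_int[of "int r"] by simp
next
  case False
  then have "[r = 1] (mod 3)" using assms by (intro prime_dvd_enorm_cong_1)
  then obtain \<chi> where "prime_cubic_character r \<chi>"
    using prime_cubic_character_exists assms(1) by blast
  then interpret prime_cubic_character r \<chi> .
  let ?J = jacobi_sum
  have "3 dvd om ?J" "3 dvd re ?J + 1"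
    using three_dvd_jacobi_sum_plus_1[OF assms(2)] of_int_dvd_eis_iff[of 3 "?J + 1"] by auto
  moreover from this have "\<not> 3 dvd re ?J" "\<not> 3 dvd re ?J - om ?J" by presburger+
  ultimately have "primary ?J" "primary (econj ?J)" by (simp_all add: primary_def)
  moreover have "?J dvd A \<or> econj ?J dvd A"
    using assms(1,3) by (intro dvd_or_econj_dvd) (simp_all add: enorm_jacobi_sum)
  ultimately show ?thesis
    using that cubic_reciprocity_jacobi_sum cubic_reciprocity_econj[OF cubic_reciprocity_jacobi_sum]
    by (metis dvd_refl enorm_jacobi_sum enorm_simps(2))
qed

lemma primary_enorm_1:
  assumes "primary A" "enorm A = 1"
  shows "A = of_int (re A)"
proof -
  obtain b where b: "om A = 3 * b" using assms(1) by (auto simp: primary_def)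
  have "(2 * re A - om A)\<^sup>2 + 27 * b\<^sup>2 = 4"
    using four_enorm[of A] assms(2) by (simp add: b power_mult_distrib)
  then have "b\<^sup>2 < 1" by (smt (verit) zero_le_power2)
  then have "b = 0" by (smt (verit) zero_less_power2)
  then show ?thesis using b by (intro eis_eqI) simp_all
qed

theorem primary_cubic_reciprocity:
  assumes "primary A"
  shows "\<exists>\<chi>. cubic_reciprocity A \<chi>"
  using assms
proof (induction "nat (enorm A)" arbitrary: A rule: less_induct)
  case (less A)
  have "A \<noteq> 0" using less.prems by (auto simp: primary_def)
  then have pos: "enorm A > 0" using enorm_nonneg[of A] enorm_eq_0_iff[of A] by simp
  show ?case
  proof (cases "enorm A = 1")
    case True
    then show ?thesis
      using cubic_reciprocity_of_int[of "re A"] primary_enorm_1[OF less.prems] by metis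
  next
    case False
    then have "nat (enorm A) \<noteq> 1" using pos by simp
    then obtain r where r: "prime r" "r dvd nat (enorm A)" using prime_factor_nat by blast
    then have r_dvd: "int r dvd enorm A" using pos by (metis int_dvd_int_iff nat_0_le less_imp_le)
    then have "r \<noteq> 3" using not_three_dvd_enorm_primary[OF less.prems] by auto
    then obtain K \<chi> where K: "cubic_reciprocity K \<chi>" "primary K" "K dvd A" "int r dvd enorm K"
      using primary_reciprocity_factor_exists r(1) r_dvd by blast
    then obtain B where A_eq: "A = K * B" by (blast elim: dvdE)
    then have "enorm K \<noteq> 0" "enorm B \<noteq> 0" using pos by auto
    then have norms: "enorm K > 0" "enorm B > 0"
      using enorm_nonneg[of K] enorm_nonneg[of B] by simp_all
    then have "int r \<le> enorm K" using K(4) by (intro zdvd_imp_le)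
    then have "enorm B < enorm A" using prime_gt_1_nat[OF r(1)] norms by (simp add: A_eq)
    then have "nat (enorm B) < nat (enorm A)" using pos by simp
    moreover have "primary B" using less.prems K(2) unfolding A_eq by (rule primary_cofactor)
    ultimately obtain \<psi> where "cubic_reciprocity B \<psi>" using less.hyps by blast
    then show ?thesis using K(1) cubic_reciprocity_mult A_eq by blast
  qed
qed

section \<open>The cubic residue symbol of \<open>x + y \<theta>\<close>\<close>

definition omega_symbol :: "int \<Rightarrow> eis" where
  "omega_symbol a = (if 3 dvd a then 0 else \<omega> ^ nat ((a\<^sup>2 - 1) div 3))"

lemma square_if_not_three_dvd:
  assumes "\<not> 3 dvd (a :: int)"
  obtains k where "a\<^sup>2 = 3 * int k + 1"
proof -
  have "a mod 3 = 1 \<or> a mod 3 = 2" using assms by presburger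
  then have "(a mod 3)\<^sup>2 mod 3 = 1" by auto
  then have "a\<^sup>2 = 3 * (a\<^sup>2 div 3) + 1" by (metis mult_div_mod_eq power_mod)
  moreover have "a\<^sup>2 div 3 \<ge> 0" by (simp add: pos_imp_zdiv_nonneg_iff)
  ultimately show ?thesis using that[of "nat (a\<^sup>2 div 3)"] by simp
qed

lemma omega_symbol_eq:
  assumes "a\<^sup>2 = 3 * int k + 1"
  shows "omega_symbol a = \<omega> ^ k"
proof -
  have "\<not> 3 dvd a\<^sup>2" unfolding assms by presburger
  then have "\<not> 3 dvd a" by (auto simp: power2_eq_square)
  then show ?thesis by (simp add: omega_symbol_def assms)
qed

lemma omega_symbol_prime:
  assumes "prime q" "q \<noteq> 3"
  shows "omega_symbol (int q) = \<omega> ^ cubic_exponent q"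
proof (rule omega_symbol_eq)
  have "int (q\<^sup>2) = int (Suc (3 * cubic_exponent q))" by (simp only: prime_square_eq_Suc[OF assms])
  then show "(int q)\<^sup>2 = 3 * int (cubic_exponent q) + 1" by simp
qed

lemma cubic_power_omega_power:
  assumes "prime q" "q \<noteq> 3"
  shows "cubic_power q (\<omega> ^ j) = omega_symbol (int q) ^ j"
  by (simp add: cubic_power_def omega_symbol_prime[OF assms] mult.commute flip: power_mult)

lemma omega_symbol_mult: "omega_symbol (a * b) = omega_symbol a * omega_symbol b"
proof (cases "3 dvd a \<or> 3 dvd b")
  case False
  then obtain k l where kl: "a\<^sup>2 = 3 * int k + 1" "b\<^sup>2 = 3 * int l + 1"
    using square_if_not_three_dvd by metis
  then have "(a * b)\<^sup>2 = 3 * int (3 * (k * l) + (k + l)) + 1"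
    by (simp add: power_mult_distrib algebra_simps)
  then have "omega_symbol (a * b) = \<omega> ^ (3 * (k * l) + (k + l))" by (rule omega_symbol_eq)
  also have "\<dots> = \<omega> ^ k * \<omega> ^ l" by (simp add: power_add power_mult)
  finally show ?thesis using kl by (simp add: omega_symbol_eq)
qed (auto simp: omega_symbol_def)

lemma omega_symbol_cong:
  assumes "[a = b] (mod 9)"
  shows "omega_symbol a = omega_symbol b"
proof (cases "3 dvd a")
  case True
  then have "3 dvd b" using assms unfolding cong_iff_dvd_diff by presburger
  then show ?thesis using True by (simp add: omega_symbol_def)
next
  case False
  then have "\<not> 3 dvd b" using assms unfolding cong_iff_dvd_diff by presburger
  with False obtain k l where kl: "a\<^sup>2 = 3 * int k + 1" "b\<^sup>2 = 3 * int l + 1"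
    using square_if_not_three_dvd by metis
  have "9 dvd a\<^sup>2 - b\<^sup>2" using cong_pow[OF assms] by (simp add: cong_iff_dvd_diff)
  then have "9 dvd 3 * (int k - int l)" by (simp add: kl)
  then have "3 dvd int k - int l" by presburger
  then have "k mod 3 = l mod 3" by presburger
  then have "\<omega> ^ k = \<omega> ^ l" using omega_power_mod[of k] omega_power_mod[of l] by simp
  then show ?thesis using kl by (simp add: omega_symbol_eq)
qed

lemma omega_symbol_cube:
  assumes "\<not> 3 dvd a"
  shows "omega_symbol a ^ 3 = 1"
  using assms by (simp add: omega_symbol_def)

interpretation omega_symbol: cubic_character 9 omega_symbol
proof
  fix a :: int assume "coprime a 9"
  then have "\<not> 3 dvd a" using coprime_common_divisor[of a 9 3] by auto
  then show "omega_symbol a ^ 3 = 1" by (rule omega_symbol_cube)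
qed (fact omega_symbol_mult omega_symbol_cong)+

lemma multiplicative_eqI:
  fixes f g :: "int \<Rightarrow> 'a::semigroup_mult"
  assumes "\<And>a b. f (a * b) = f a * f b" "\<And>a b. g (a * b) = g a * g b"
    and "f 1 = g 1" "f (- 1) = g (- 1)"
    and "\<And>q. prime q \<Longrightarrow> q dvd c \<Longrightarrow> f q = g q" and "c \<noteq> 0"
  shows "f c = g c"
  using assms(5,6)
proof (induction c rule: prime_divisors_induct)
  case (unit c)
  then have "c = 1 \<or> c = - 1" by (auto simp: zdvd1_eq)
  then show ?case using assms(3,4) by auto
next
  case (factor q c)
  then have "f q = g q" "f c = g c" by (auto intro: dvd_mult)
  then show ?case by (simp add: assms(1,2))
qed simp

definition theta_form :: "int \<Rightarrow> int \<Rightarrow> eis" where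
  "theta_form x y = of_int x + of_int y * \<theta>"

lemma theta_form_sel [simp]: "re (theta_form x y) = x + y" "om (theta_form x y) = 2 * y"
  by (simp_all add: theta_form_def)

lemma enorm_theta_form [simp]: "enorm (theta_form x y) = x\<^sup>2 + 3 * y\<^sup>2"
  by (simp add: enorm_def power2_eq_square algebra_simps)

context
  fixes x y :: int
  assumes xy: "coprime x y" "odd (x + y)" "\<not> 3 dvd x"
begin

lemma prime_dvd_linear_form_not_2_3:
  assumes "int q dvd x - 3 * e * y" "e = 1 \<or> e = - 1"
  shows "q \<noteq> 2" "q \<noteq> 3"
proof -
  show "q \<noteq> 2"
  proof
    assume "q = 2"
    then have "even (x - 3 * e * y)" using assms(1) by simp
    then show False using xy(2) assms(2) by auto
  qed
  show "q \<noteq> 3"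
  proof
    assume "q = 3"
    then have "3 dvd x - 3 * e * y + 3 * e * y" using assms(1) by (intro dvd_add) simp_all
    then show False using xy(3) by simp
  qed
qed

lemma prime_dvd_linear_form_not_dvd:
  assumes "prime q" "int q dvd x - 3 * e * y" "e = 1 \<or> e = - 1"
  shows "\<not> int q dvd 2 * y" "\<not> int q dvd x\<^sup>2 + 3 * y\<^sup>2"
proof -
  have prime: "prime (int q)" using assms(1) by simp
  have not_dvd_y: "\<not> int q dvd y"
  proof
    assume "int q dvd y"
    moreover from this have "int q dvd x - 3 * e * y + 3 * e * y"
      using assms(2) by (intro dvd_add) simp_all
    ultimately show False
      using xy(1) prime by (metis coprime_common_divisor diff_add_cancel not_prime_unit)
  qed
  have not_dvd_2_3: "\<not> int q dvd 2" "\<not> int q dvd 3"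
    using prime_dvd_linear_form_not_2_3[OF assms(2,3)] assms(1)
      primes_dvd_imp_eq[of q 2] primes_dvd_imp_eq[of q 3]
      int_dvd_int_iff[of q 2] int_dvd_int_iff[of q 3] by auto
  then show "\<not> int q dvd 2 * y" using prime not_dvd_y by (simp add: prime_dvd_mult_iff)
  show "\<not> int q dvd x\<^sup>2 + 3 * y\<^sup>2"
  proof
    assume "int q dvd x\<^sup>2 + 3 * y\<^sup>2"
    then have "int q dvd x\<^sup>2 + 3 * y\<^sup>2 - (x - 3 * e * y) * (x + 3 * e * y)"
      using assms(2) by (intro dvd_diff) auto
    also have "\<dots> = 2 * 2 * 3 * y * y"
      using assms(3) by (auto simp: power2_eq_square algebra_simps)
    finally show False
      using prime not_dvd_2_3 not_dvd_y by (simp only: prime_dvd_mult_iff simp_thms)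
  qed
qed

lemma cubic_power_theta_form_at_linear_form:
  assumes "prime q" "int q dvd x - 3 * e * y" "(e, i) = (1, 1) \<or> (e, i) = (- 1, 2)"
  shows "[cubic_power q (theta_form x y) \<equiv> omega_symbol (int q) ^ i] (mod q)"
proof -
  have e: "e = 1 \<or> e = - 1" using assms(3) by auto
  have q_ne_3: "q \<noteq> 3" using assms(2) e by (rule prime_dvd_linear_form_not_2_3)
  have not_dvd: "\<not> int q dvd - 2 * y"
    using prime_dvd_linear_form_not_dvd(1)[OF assms(1,2) e] by simp
  have "theta_form x y - of_int (- 2 * y) * \<omega> ^ i * \<theta> = of_int (x - 3 * e * y)"
    using assms(3) by (auto simp: power2_eq_square intro!: eis_eqI)
  then have "[theta_form x y \<equiv> of_int (- 2 * y) * \<omega> ^ i * \<theta>] (mod q)"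
    using assms(2) by (simp add: cong2_0_iff of_nat_dvd_eis_iff)
  then have "[cubic_power q (theta_form x y)
      \<equiv> cubic_power q (of_int (- 2 * y) * \<omega> ^ i * \<theta>)] (mod q)"
    by (rule cubic_power_cong)
  also have "cubic_power q (of_int (- 2 * y) * \<omega> ^ i * \<theta>)
      = cubic_power q (of_int (- 2 * y)) * omega_symbol (int q) ^ i * cubic_power q \<theta>"
    by (simp only: cubic_power_mult cubic_power_omega_power[OF assms(1) q_ne_3])
  also have "[\<dots> \<equiv> 1 * omega_symbol (int q) ^ i * 1] (mod q)"
    by (intro cong2_mult cong2_refl cubic_power_of_int_cong cubic_power_theta_cong assms(1) q_ne_3
        not_dvd)
  finally show ?thesis by simp
qed

lemma reciprocity_at_linear_form:
  assumes \<chi>: "cubic_reciprocity (\<omega> ^ j * theta_form x y) \<chi>"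
    and "(e, i) = (1, 1) \<or> (e, i) = (- 1, 2)"
  shows "\<chi> (x - 3 * e * y) = omega_symbol (x - 3 * e * y) ^ (j + i)"
proof -
  interpret cubic_reciprocity "\<omega> ^ j * theta_form x y" \<chi> by fact
  have e: "e = 1 \<or> e = - 1" using assms(2) by auto
  show ?thesis
  proof (rule multiplicative_eqI)
    fix q :: int assume q: "prime q" "q dvd x - 3 * e * y"
    then obtain n where n: "q = int n" "prime n"
      by (metis prime_ge_0_int zero_le_imp_eq_int prime_nat_int_transfer)
    note dvd = q(2)[unfolded n(1)]
    have n_ne_3: "n \<noteq> 3" using dvd e by (rule prime_dvd_linear_form_not_2_3)
    have not_dvd: "\<not> int n dvd x\<^sup>2 + 3 * y\<^sup>2"
      using n(2) dvd e by (rule prime_dvd_linear_form_not_dvd)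
    have "[\<chi> (int n) \<equiv> cubic_power n (\<omega> ^ j * theta_form x y)] (mod n)"
      using n(2) n_ne_3 not_dvd by (intro cong2_sym[OF reciprocity]) simp_all
    also have "cubic_power n (\<omega> ^ j * theta_form x y)
        = omega_symbol (int n) ^ j * cubic_power n (theta_form x y)"
      by (simp only: cubic_power_mult cubic_power_omega_power[OF n(2) n_ne_3])
    also have "[\<dots> \<equiv> omega_symbol (int n) ^ j * omega_symbol (int n) ^ i] (mod n)"
      by (intro cong2_scalar_left cubic_power_theta_form_at_linear_form[OF n(2) dvd assms(2)])
    finally have cong: "[\<chi> (int n) \<equiv> omega_symbol (int n) ^ (j + i)] (mod n)"
      by (simp only: power_add)
    have "coprime (int n) (x\<^sup>2 + 3 * y\<^sup>2)" using n(2) not_dvd by (simp add: prime_imp_coprime)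
    then have cube: "\<chi> (int n) ^ 3 = 1" by (intro chi_cube) simp
    have "(omega_symbol (int n) ^ (j + i)) ^ 3 = 1"
      unfolding omega_symbol_prime[OF n(2) n_ne_3] power_mult[of _ _ "j + i", symmetric]
      by (rule omega_power_cube)
    with n(2) cube have "\<chi> (int n) = omega_symbol (int n) ^ (j + i)"
      using cong by (rule cube_roots_of_unity_cong_imp_eq)
    then show "\<chi> q = omega_symbol q ^ (j + i)" by (simp only: n(1))
  next
    show "x - 3 * e * y \<noteq> 0" using xy(3) by auto
  qed (simp_all add: chi_mult chi_1 chi_minus omega_symbol_mult omega_symbol.chi_1
      omega_symbol.chi_minus power_mult_distrib)
qed

lemma cubic_power_theta_form_cong_symbols:
  assumes "prime p" "p \<noteq> 3" "\<not> int p dvd x\<^sup>2 + 3 * y\<^sup>2" "primary (\<omega> ^ j * theta_form x y)"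
    and p: "[int p = e * ((x - 3 * y) * (x + 3 * y))] (mod x\<^sup>2 + 3 * y\<^sup>2)" "e = 1 \<or> e = - 1"
  shows "[cubic_power p (theta_form x y) \<equiv> omega_symbol (int p) ^ (2 * j) *
    (omega_symbol (x - 3 * y) ^ (j + 1) * omega_symbol (x + 3 * y) ^ (j + 2))] (mod p)"
proof -
  let ?A = "theta_form x y" and ?W = "omega_symbol (int p)"
  obtain \<chi> where \<chi>: "cubic_reciprocity (\<omega> ^ j * ?A) \<chi>"
    using primary_cubic_reciprocity[OF assms(4)] by blast
  interpret cubic_reciprocity "\<omega> ^ j * ?A" \<chi> by fact
  have "\<chi> (int p) = \<chi> (e * ((x - 3 * y) * (x + 3 * y)))" using p(1) by (intro chi_cong) simp
  also have "\<dots> = \<chi> (x - 3 * 1 * y) * \<chi> (x - 3 * (- 1) * y)"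
    using p(2) by (auto simp: chi_mult chi_1 chi_minus)
  also have "\<dots> = omega_symbol (x - 3 * y) ^ (j + 1) * omega_symbol (x + 3 * y) ^ (j + 2)"
    using reciprocity_at_linear_form[OF \<chi>, of 1 1] reciprocity_at_linear_form[OF \<chi>, of "- 1" 2]
    by simp
  finally have \<chi>_p: "\<chi> (int p) = \<dots>" .
  have "cubic_power p ?A = ?W ^ (2 * j) * (?W ^ j * cubic_power p ?A)"
  proof -
    have "?W ^ (2 * j) * ?W ^ j = (?W ^ 3) ^ j" by (simp flip: power_mult power_add)
    then show ?thesis by (simp add: omega_symbol_prime[OF assms(1,2)] flip: mult.assoc)
  qed
  also have "?W ^ j * cubic_power p ?A = cubic_power p (\<omega> ^ j * ?A)"
    by (simp only: cubic_power_mult cubic_power_omega_power[OF assms(1,2)])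
  also have "[?W ^ (2 * j) * \<dots> \<equiv> ?W ^ (2 * j) * \<chi> (int p)] (mod p)"
    using assms(1-3) by (intro cong2_scalar_left reciprocity) simp_all
  finally show ?thesis by (simp only: \<chi>_p)
qed

lemma cubic_power_theta_form_if_three_dvd:
  assumes "prime p" "p \<noteq> 3" "\<not> int p dvd x\<^sup>2 + 3 * y\<^sup>2"
    and "[int p = e * ((x - 3 * y) * (x + 3 * y))] (mod x\<^sup>2 + 3 * y\<^sup>2)" "e = 1 \<or> e = - 1"
    and "3 dvd y"
  shows "[cubic_power p (theta_form x y) \<equiv> 1] (mod p)"
proof -
  have "\<not> 3 dvd x + y" using xy(3) assms(6) by presburger
  then have primary: "primary (\<omega> ^ 0 * theta_form x y)"
    using assms(6) by (simp add: primary_def)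
  have "[x - 3 * y = x + 3 * y] (mod 9)"
    using assms(6) unfolding cong_iff_dvd_diff by presburger
  then have "omega_symbol (x - 3 * y) = omega_symbol (x + 3 * y)" by (rule omega_symbol_cong)
  moreover have "\<not> 3 dvd x + 3 * y" using xy(3) by presburger
  ultimately have "omega_symbol (x - 3 * y) * omega_symbol (x + 3 * y) ^ 2 = 1"
    using omega_symbol_cube[of "x + 3 * y"]
    by (simp add: power2_eq_square power3_eq_cube mult.assoc)
  then show ?thesis using cubic_power_theta_form_cong_symbols[OF assms(1-3) primary assms(4,5)]
    by (simp add: power2_eq_square)
qed

lemma cubic_power_theta_form_if_three_dvd_diff:
  assumes "prime p" "p \<noteq> 3" "\<not> int p dvd x\<^sup>2 + 3 * y\<^sup>2"
    and "[int p = e * ((x - 3 * y) * (x + 3 * y))] (mod x\<^sup>2 + 3 * y\<^sup>2)" "e = 1 \<or> e = - 1"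
    and "3 dvd y - x" "[(x - 3 * y) * int p = c * x ^ 3] (mod 9)"
  shows "[cubic_power p (theta_form x y) \<equiv> omega_symbol c ^ 2] (mod p)"
proof -
  have "\<not> 3 dvd 2 * y" "3 dvd x - y" using xy(3) assms(6) by presburger+
  then have primary: "primary (\<omega> ^ 1 * theta_form x y)" by (simp add: primary_def)
  have "\<not> 3 dvd x + 3 * y" using xy(3) by presburger
  then have cube: "omega_symbol (x + 3 * y) ^ 3 = 1" by (rule omega_symbol_cube)
  have "omega_symbol (x - 3 * y) * omega_symbol (int p) = omega_symbol (c * x ^ 3)"
    using omega_symbol_cong[OF assms(7)] by (simp only: omega_symbol_mult)
  also have "\<dots> = omega_symbol c"
    using omega_symbol_cube[OF xy(3)]
    by (simp add: omega_symbol_mult omega_symbol.chi_power)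
  finally have "omega_symbol (int p) ^ 2 * omega_symbol (x - 3 * y) ^ 2 = omega_symbol c ^ 2"
    by (simp add: mult.commute flip: power_mult_distrib)
  then show ?thesis
    using cubic_power_theta_form_cong_symbols[OF assms(1-3) primary assms(4,5)] cube
    by (simp add: numeral_2_eq_2 numeral_3_eq_3)
qed

end

section \<open>Fibonacci numbers modulo a prime\<close>

lemma fib_binet_cong2:
  fixes \<phi> \<psi> :: "'a::comm_ring_1"
  assumes "[\<phi> + \<psi> = 1] (mod l, m)" "[\<phi> * \<psi> = - 1] (mod l, m)"
  shows "[of_nat (fib n) * (\<phi> - \<psi>) = \<phi> ^ n - \<psi> ^ n] (mod l, m)"
proof (induction n rule: fib.induct)
  case (3 n)
  let ?d = "\<lambda>k. \<phi> ^ k - \<psi> ^ k"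
  have "of_nat (fib (Suc (Suc n))) * (\<phi> - \<psi>)
      = of_nat (fib (Suc n)) * (\<phi> - \<psi>) + of_nat (fib n) * (\<phi> - \<psi>)"
    by (simp add: algebra_simps)
  also have "[\<dots> = ?d (Suc n) + ?d n] (mod l, m)" by (intro cong2_add 3)
  also have "?d (Suc n) + ?d n = 1 * ?d (Suc n) - (- 1) * ?d n" by simp
  also have "[\<dots> = (\<phi> + \<psi>) * ?d (Suc n) - (\<phi> * \<psi>) * ?d n] (mod l, m)"
    by (intro cong2_diff cong2_mult cong2_refl assms[THEN cong2_sym])
  also have "(\<phi> + \<psi>) * ?d (Suc n) - (\<phi> * \<psi>) * ?d n = ?d (Suc (Suc n))"
    by (simp add: algebra_simps)
  finally show ?case .
qed simp_all

context
  fixes p :: nat and \<phi> :: eis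
  assumes p: "prime p" "p > 3"
    and trace: "[2 * re \<phi> - om \<phi> = 1] (mod int p)" and norm: "[enorm \<phi> = - 1] (mod int p)"
begin

lemma golden_sum_cong: "[\<phi> + econj \<phi> \<equiv> 1] (mod p)"
  using trace by (simp add: eis_cong_iff)

lemma golden_product_cong: "[\<phi> * econj \<phi> \<equiv> - 1] (mod p)"
  using norm by (simp add: mult_econj eis_cong_iff)

lemma golden_cubic_power_cong: "[cubic_power p \<phi> \<equiv> \<phi> ^ cubic_exponent p] (mod p)"
proof -
  have "odd (p\<^sup>2)" using p prime_odd_nat[of p] by simp
  then have even: "even (cubic_exponent p)" using prime_square_eq_Suc[of p] p by simp
  have "[\<phi> * of_int (enorm \<phi>) \<equiv> \<phi> * - 1] (mod p)"
    unfolding mult_econj[symmetric] by (rule cong2_scalar_left[OF golden_product_cong])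
  then have "[cubic_power p \<phi> \<equiv> (\<phi> * - 1) ^ cubic_exponent p] (mod p)"
    unfolding cubic_power_def by (rule cong2_power)
  then show ?thesis using even by simp
qed

lemma golden_power_cong_split:
  assumes "p = 3 * n + 1" and \<zeta>: "[cubic_power p \<phi> \<equiv> \<zeta>] (mod p)"
  shows "[\<phi> ^ (2 * n + 1) \<equiv> \<zeta> * \<phi>] (mod p)"
proof -
  have exponent: "cubic_exponent p = p * n + n"
    by (simp add: cubic_exponent_def assms(1) power2_eq_square algebra_simps)
  have "[\<phi> ^ p \<equiv> \<phi>] (mod p)" using frobenius_eis[of p \<phi>] p assms(1) by simp
  then have "[\<phi> ^ n * \<phi> ^ n \<equiv> (\<phi> ^ p) ^ n * \<phi> ^ n] (mod p)"
    by (intro cong2_mult cong2_refl cong2_power cong2_sym[of _ _ "\<phi> ^ p"])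
  also have "(\<phi> ^ p) ^ n * \<phi> ^ n = \<phi> ^ cubic_exponent p"
    by (simp add: exponent power_add power_mult)
  also have "[\<dots> \<equiv> \<zeta>] (mod p)"
    by (rule cong2_trans[OF cong2_sym[OF golden_cubic_power_cong] \<zeta>])
  finally have "[\<phi> ^ n * \<phi> ^ n * \<phi> \<equiv> \<zeta> * \<phi>] (mod p)" by (intro cong2_mult cong2_refl)
  then show ?thesis by (simp only: mult_2 power_add power_one_right)
qed

lemma golden_power_cong_inert:
  assumes "p = 3 * n + 2" and \<zeta>: "[cubic_power p \<phi> \<equiv> \<zeta>] (mod p)"
  shows "[econj \<phi> ^ (2 * n + 1) \<equiv> - (\<zeta> * \<phi>)] (mod p)"
proof -
  have exponent: "cubic_exponent p + (n + 1) = p * (n + 1)"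
    by (simp add: cubic_exponent_def assms(1) power2_eq_square algebra_simps)
  have odd: "odd n" using p assms(1) prime_odd_nat[of p] by simp
  have "p mod 3 = 2" using assms(1) by presburger
  then have "[\<phi> ^ p \<equiv> econj \<phi>] (mod p)" using frobenius_eis[of p \<phi>] p by simp
  then have "[econj \<phi> ^ (n + 1) \<equiv> (\<phi> ^ p) ^ (n + 1)] (mod p)"
    by (intro cong2_power cong2_sym[of _ _ "\<phi> ^ p"])
  also have "(\<phi> ^ p) ^ (n + 1) = \<phi> ^ cubic_exponent p * \<phi> ^ (n + 1)"
    by (simp only: power_mult[symmetric] power_add[symmetric] exponent)
  also have "[\<dots> \<equiv> \<zeta> * \<phi> ^ (n + 1)] (mod p)"
    by (intro cong2_mult cong2_refl cong2_trans[OF cong2_sym[OF golden_cubic_power_cong] \<zeta>])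
  finally have conj_power: "[econj \<phi> ^ (n + 1) \<equiv> \<zeta> * \<phi> ^ (n + 1)] (mod p)" .
  have "econj \<phi> ^ (2 * n + 1) = econj \<phi> ^ n * econj \<phi> ^ (n + 1)"
    by (simp add: mult_2 power_add)
  also have "[\<dots> \<equiv> econj \<phi> ^ n * (\<zeta> * \<phi> ^ (n + 1))] (mod p)"
    using conj_power by (rule cong2_scalar_left)
  also have "econj \<phi> ^ n * (\<zeta> * \<phi> ^ (n + 1)) = \<zeta> * \<phi> * (\<phi> * econj \<phi>) ^ n"
    by (simp add: power_mult_distrib mult_ac)
  also have "[\<dots> \<equiv> \<zeta> * \<phi> * (- 1) ^ n] (mod p)"
    by (intro cong2_scalar_left cong2_power golden_product_cong)
  finally show ?thesis using odd by simp
qed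

lemma fib_mult_om_golden_cong:
  assumes "[cubic_power p \<phi> \<equiv> \<zeta>] (mod p)"
  shows "[int (fib (2 * (p div 3) + 1)) * om \<phi> = om (\<zeta> * \<phi>)] (mod int p)"
proof -
  define n where "n = p div 3"
  let ?z = "\<zeta> * \<phi>"
  have diff_econj: "a - econj a = of_int (om a) * \<theta>" for a by (rule eis_eqI) simp_all
  have "[\<phi> ^ (2 * n + 1) - econj \<phi> ^ (2 * n + 1) \<equiv> ?z - econj ?z] (mod p)"
  proof -
    have "p mod 3 = 1 \<or> p mod 3 = 2" using prime_mod_3[of p] p by simp
    then have "p = 3 * n + 1 \<or> p = 3 * n + 2" unfolding n_def by presburger
    then show ?thesis
    proof
      assume "p = 3 * n + 1"
      from golden_power_cong_split[OF this assms] have "[\<phi> ^ (2 * n + 1) \<equiv> ?z] (mod p)" .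
      from cong2_diff[OF this eis_cong_econj[OF this]] show ?thesis by (simp only: econj_power)
    next
      assume "p = 3 * n + 2"
      from golden_power_cong_inert[OF this assms] have "[econj \<phi> ^ (2 * n + 1) \<equiv> - ?z] (mod p)" .
      from cong2_diff[OF eis_cong_econj[OF this] this] show ?thesis by simp
    qed
  qed
  with fib_binet_cong2[OF golden_sum_cong golden_product_cong]
  have "[of_nat (fib (2 * n + 1)) * (\<phi> - econj \<phi>) \<equiv> ?z - econj ?z] (mod p)" by (rule cong2_trans)
  then show ?thesis unfolding diff_econj by (simp add: eis_cong_iff n_def)
qed

end

text \<open>If \<open>N(B) \<equiv> - t\<^sup>2\<close> for the trace \<open>t\<close> of \<open>B\<close>, then \<open>B/t\<close> is the golden ratio modulo \<open>p\<close>.\<close>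

lemma fib_mult_om_cong:
  assumes p: "prime p" "p > 3" and t: "t = 2 * re B - om B" "\<not> int p dvd t"
    and norm: "[enorm B = - t\<^sup>2] (mod int p)" and power: "[cubic_power p B \<equiv> \<zeta>] (mod p)"
  shows "[int (fib (2 * (p div 3) + 1)) * om B = om (\<zeta> * B)] (mod int p)"
proof -
  let ?F = "int (fib (2 * (p div 3) + 1))"
  have "coprime t (int p)"
    using p(1) t(2) prime_imp_coprime[of "int p" t] by (simp add: coprime_commute)
  then obtain i where i: "[t * i = 1] (mod int p)" using cong_solve_coprime_int by blast
  then have coprime: "coprime i (int p)" by (metis coprime_iff_invertible_int mult.commute)
  then have "\<not> int p dvd i" using prime_gt_1_nat[OF p(1)] coprime_absorb_right[of "int p" i] by auto
  then have "[cubic_power p (of_int i) * cubic_power p B \<equiv> 1 * \<zeta>] (mod p)"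
    using p by (intro cong2_mult power cubic_power_of_int_cong) simp_all
  then have "[cubic_power p (of_int i * B) \<equiv> \<zeta>] (mod p)" by (simp add: cubic_power_mult)
  moreover have "[2 * re (of_int i * B) - om (of_int i * B) = 1] (mod int p)"
    using i by (simp add: t algebra_simps)
  moreover have "[enorm (of_int i * B) = - 1] (mod int p)"
  proof -
    have "[i\<^sup>2 * enorm B = i\<^sup>2 * - t\<^sup>2] (mod int p)" using norm by (rule cong_scalar_left)
    also have "i\<^sup>2 * - t\<^sup>2 = - (t * i)\<^sup>2" by (simp add: power_mult_distrib)
    also have "[\<dots> = - 1\<^sup>2] (mod int p)" using i by (intro cong_uminus cong_pow)
    finally show ?thesis by simp
  qed
  ultimately have "[?F * om (of_int i * B) = om (\<zeta> * (of_int i * B))] (mod int p)"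
    using p by (intro fib_mult_om_golden_cong)
  then have "[i * (?F * om B) = i * om (\<zeta> * B)] (mod int p)" by (simp add: algebra_simps)
  then show ?thesis using coprime by (simp add: cong_mult_lcancel)
qed

lemma coprime_if_prime_eq_form:
  fixes a b x y :: int
  assumes "prime p" "int p = a * x\<^sup>2 + b * y\<^sup>2"
  shows "coprime x y"
proof (rule coprimeI)
  fix d assume "d dvd x" "d dvd y"
  then have "d\<^sup>2 dvd int p" unfolding assms(2) by (intro dvd_add dvd_mult dvd_power_same)
  then obtain e where e: "int p = d * (d * e)" by (auto simp: power2_eq_square mult.assoc dvd_def)
  have "irreducible (int p)" using assms(1) by (simp add: prime_elem_imp_irreducible)
  then have "is_unit d \<or> is_unit (d * e)" using e by (rule irreducibleD)
  then show "is_unit d" using dvd_mult_left by blast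
qed

context
  fixes p :: nat and a b x y :: int
  assumes p: "prime p" "p > 5" and form: "int p = a * x\<^sup>2 + b * y\<^sup>2"
    and ab: "(a, b) = (1, 15) \<or> (a, b) = (5, 3)"
begin

lemma coprime_form_coeffs: "coprime a (int p)" "coprime b (int p)"
proof -
  have "coprime (3 :: int) (int p)" "coprime (5 :: int) (int p)"
    using coprime_small[OF p, of 3] coprime_small[OF p, of 5] by simp_all
  moreover from this have "coprime (3 * 5 :: int) (int p)" by (simp only: coprime_mult_left_iff)
  ultimately show "coprime a (int p)" "coprime b (int p)" using ab by auto
qed

lemma not_dvd_form_variables:
  "\<not> int p dvd x" "\<not> int p dvd y" "\<not> int p dvd 2 * x" "\<not> int p dvd 2 * y"
proof -
  have "coprime (2 * x) (int p)"
    using coprime_denominator_form(1)[OF p coprime_form_coeffs(2), of y a x] form by simp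
  moreover have "coprime (2 * y) (int p)"
    using coprime_denominator_form(1)[OF p coprime_form_coeffs(1) form] .
  moreover have "\<not> is_unit (int p)" using p(2) by simp
  ultimately show "\<not> int p dvd 2 * x" "\<not> int p dvd 2 * y"
    by (metis coprime_common_divisor dvd_refl)+
  then show "\<not> int p dvd x" "\<not> int p dvd y" by (metis dvd_mult)+
qed

lemma coprime_odd_form_variables: "coprime x y" "odd (x + y)" "\<not> 3 dvd x"
proof -
  show "coprime x y" using p(1) form by (rule coprime_if_prime_eq_form)
  have "odd (a * x\<^sup>2 + b * y\<^sup>2)" using p prime_odd_nat[of p] by (simp flip: form)
  then show "odd (x + y)" using ab by auto
  have "3 dvd b" using ab by auto
  show "\<not> 3 dvd x"
  proof
    assume "3 dvd x"
    then have "3 dvd int p" unfolding form using \<open>3 dvd b\<close> by (simp add: power2_eq_square)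
    then have "3 dvd p" by presburger
    then show False using p primes_dvd_imp_eq[of 3 p] by simp
  qed
qed

lemma not_dvd_enorm_theta_form: "\<not> int p dvd x\<^sup>2 + 3 * y\<^sup>2"
proof
  assume "int p dvd x\<^sup>2 + 3 * y\<^sup>2"
  then have "int p dvd a * x\<^sup>2 + b * y\<^sup>2 - (x\<^sup>2 + 3 * y\<^sup>2)" unfolding form[symmetric] by simp
  then have "int p dvd 3 * (2 * y * (2 * y)) \<or> int p dvd 2 * x * (2 * x)"
    using ab by (auto simp: power2_eq_square)
  moreover have "\<not> int p dvd 3" using p(2) by (auto dest: zdvd_imp_le)
  ultimately show False
    using p(1) not_dvd_form_variables(3,4) prime_dvd_mult_iff[of "int p"]
    by (metis prime_nat_int_transfer)
qed

lemma prime_form_cong_linear_forms: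
  obtains e where "e = 1 \<or> e = - 1" "[int p = e * ((x - 3 * y) * (x + 3 * y))] (mod x\<^sup>2 + 3 * y\<^sup>2)"
proof -
  have "int p - - 1 * ((x - 3 * y) * (x + 3 * y)) = (x\<^sup>2 + 3 * y\<^sup>2) * 2 \<or>
      int p - 1 * ((x - 3 * y) * (x + 3 * y)) = (x\<^sup>2 + 3 * y\<^sup>2) * 4"
    using ab by (auto simp: form power2_eq_square algebra_simps)
  then show ?thesis
    using that[of "- 1"] that[of 1] unfolding cong_iff_dvd_diff by (metis dvd_triv_left)
qed

lemma cubic_power_theta_form_prime:
  "3 dvd y \<Longrightarrow> [cubic_power p (theta_form x y) \<equiv> 1] (mod p)"
  "3 dvd y - x \<Longrightarrow> [cubic_power p (theta_form x y) \<equiv> omega_symbol (2 * (a + b)) ^ 2] (mod p)"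
proof -
  obtain e where e: "e = 1 \<or> e = - 1"
    "[int p = e * ((x - 3 * y) * (x + 3 * y))] (mod x\<^sup>2 + 3 * y\<^sup>2)"
    by (rule prime_form_cong_linear_forms)
  have p_ne_3: "p \<noteq> 3" using p(2) by simp
  show "[cubic_power p (theta_form x y) \<equiv> 1] (mod p)" if "3 dvd y"
    using coprime_odd_form_variables p(1) p_ne_3 not_dvd_enorm_theta_form e(2,1) that
    by (rule cubic_power_theta_form_if_three_dvd)
  show "[cubic_power p (theta_form x y) \<equiv> omega_symbol (2 * (a + b)) ^ 2] (mod p)" if "3 dvd y - x"
  proof -
    obtain n where n: "y = x + 3 * n"
      using \<open>3 dvd y - x\<close> by (metis dvdE add.commute diff_add_cancel)
    obtain l where l: "b = 3 * l" using ab by auto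
    have "(x - 3 * y) * int p - - (2 * (a + b)) * x ^ 3
        = 9 * (- n * (a * x\<^sup>2 + b * y\<^sup>2) - 2 * x * l * (2 * x * n + 3 * n\<^sup>2))"
      by (simp add: form n l power2_eq_square power3_eq_cube algebra_simps)
    then have "[(x - 3 * y) * int p = - (2 * (a + b)) * x ^ 3] (mod 9)"
      unfolding cong_iff_dvd_diff by (metis dvd_triv_left)
    with coprime_odd_form_variables p(1) p_ne_3 not_dvd_enorm_theta_form e(2,1) that
    have "[cubic_power p (theta_form x y) \<equiv> omega_symbol (- (2 * (a + b))) ^ 2] (mod p)"
      by (rule cubic_power_theta_form_if_three_dvd_diff)
    then show ?thesis by (simp only: omega_symbol.chi_minus)
  qed
qed

end

lemma omega_symbol_square_values: "omega_symbol 32 ^ 2 = \<omega>" "omega_symbol 16 ^ 2 = \<omega>\<^sup>2"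
  using omega_symbol_eq[of 32 341] omega_symbol_eq[of 16 85] omega_power_mod[of 682]
  omega_power_mod[of 170]
  by (simp_all flip: power_mult)

lemma fib_mult_x_cong:
  assumes p: "prime p" "p > 5" and form: "int p = x\<^sup>2 + 15 * y\<^sup>2"
    and symbol: "[cubic_power p (theta_form x y) \<equiv> \<zeta>] (mod p)"
  shows "[int (fib (2 * (p div 3) + 1)) * (2 * x) = om (\<zeta> * (theta_form x y * \<theta>))] (mod int p)"
proof -
  let ?B = "theta_form x y * \<theta>"
  have trace: "- (3 * (2 * y)) = 2 * re ?B - om ?B" and om: "om ?B = 2 * x" by simp_all
  have "\<not> int p dvd 2 * y" using not_dvd_form_variables(4)[OF p, of 1 x 15 y] form by simp
  moreover have "\<not> int p dvd 3" using p(2) by (auto dest: zdvd_imp_le)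
  moreover have "prime (int p)" using p(1) by simp
  ultimately have "\<not> int p dvd - (3 * (2 * y))"
    by (simp only: dvd_minus_iff prime_dvd_mult_iff simp_thms)
  moreover have "[enorm ?B = - (- (3 * (2 * y)))\<^sup>2] (mod int p)"
  proof -
    have "enorm ?B - - (- (3 * (2 * y)))\<^sup>2 = int p * 3"
      by (simp add: form power2_eq_square algebra_simps)
    then show ?thesis by (simp only: cong_iff_dvd_diff dvd_triv_left)
  qed
  moreover have "[cubic_power p ?B \<equiv> \<zeta> * 1] (mod p)"
    unfolding cubic_power_mult using p by (intro cong2_mult symbol cubic_power_theta_cong) simp_all
  moreover have "p > 3" using p(2) by simp
  ultimately have "[int (fib (2 * (p div 3) + 1)) * om ?B = om (\<zeta> * 1 * ?B)] (mod int p)"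
    by (intro fib_mult_om_cong[OF p(1) _ trace])
  then show ?thesis unfolding om by simp
qed

lemma fib_cong_x2_15y2:
  fixes x y :: int
  assumes p: "prime p" "p > 5" and form: "int p = x\<^sup>2 + 15 * y\<^sup>2"
  defines "F \<equiv> int (fib (2 * (p div 3) + 1))"
  shows "3 dvd y \<Longrightarrow> [F = 1] (mod int p)"
    and "3 dvd y - x \<Longrightarrow> [10 * y * F = x - 5 * y] (mod int p)"
proof -
  have form': "int p = 1 * x\<^sup>2 + 15 * y\<^sup>2" using form by simp
  note symbol = cubic_power_theta_form_prime[OF p form', simplified]
  note not_dvd = not_dvd_form_variables[OF p form', simplified]
  note fib = fib_mult_x_cong[OF p form, folded F_def]
  have prime: "prime (int p)" using p(1) by simp
  show "[F = 1] (mod int p)" if "3 dvd y"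
  proof -
    have "[2 * x * F = 2 * x * 1] (mod int p)"
      using fib[OF symbol(1)[OF that]] by (simp add: mult.commute)
    then show ?thesis
      using prime not_dvd(3) prime_imp_coprime[of "int p" "2 * x"] cong_mult_lcancel
      by (metis coprime_commute)
  qed
  show "[10 * y * F = x - 5 * y] (mod int p)" if "3 dvd y - x"
  proof -
    have "[F * (2 * x) = - x - 3 * y] (mod int p)"
      using fib[OF symbol(2)[OF that, unfolded omega_symbol_square_values]] by simp
    then have "int p dvd F * (2 * x) - (- x - 3 * y)" by (simp only: cong_iff_dvd_diff)
    then have "int p dvd x * (F * (2 * x) - (- x - 3 * y)) - int p * (2 * F + 1)"
      by (intro dvd_diff[OF dvd_mult dvd_triv_left])
    also have "\<dots> = - 3 * y * (10 * y * F - (x - 5 * y))"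
      by (simp add: form power2_eq_square algebra_simps)
    finally have "int p dvd - 3 * y * (10 * y * F - (x - 5 * y))" .
    moreover have "\<not> int p dvd 3" using p(2) by (auto dest: zdvd_imp_le)
    ultimately have "int p dvd 10 * y * F - (x - 5 * y)"
      using prime not_dvd(2) by (auto simp: prime_dvd_mult_iff)
    then show ?thesis by (simp only: cong_iff_dvd_diff)
  qed
qed

lemma fib_cong_5x2_3y2:
  fixes x y :: int
  assumes p: "prime p" "p > 5" and form: "int p = 5 * x\<^sup>2 + 3 * y\<^sup>2"
  defines "F \<equiv> int (fib (2 * (p div 3) + 1))"
  shows "3 dvd y \<Longrightarrow> [F = 1] (mod int p)"
    and "3 dvd y - x \<Longrightarrow> [2 * y * F = - (x + y)] (mod int p)"
proof -
  let ?A = "theta_form x y"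
  note symbol = cubic_power_theta_form_prime[OF p form, simplified]
  note not_dvd = not_dvd_form_variables[OF p form, simplified]
  have fib: "[2 * y * F = om (\<zeta> * ?A)] (mod int p)" if "[cubic_power p ?A \<equiv> \<zeta>] (mod p)" for \<zeta>
  proof -
    have trace: "2 * x = 2 * re ?A - om ?A" by simp
    have "[enorm ?A = - (2 * x)\<^sup>2] (mod int p)"
      by (simp add: cong_iff_dvd_diff form power2_eq_square)
    then show ?thesis
      using fib_mult_om_cong[OF _ _ trace not_dvd(3) _ that] p by (simp add: F_def mult.commute)
  qed
  show "[F = 1] (mod int p)" if "3 dvd y"
  proof -
    have "[2 * y * F = 2 * y * 1] (mod int p)" using fib[OF symbol(1)[OF that]] by simp
    then show ?thesis
      using p(1) not_dvd(4) prime_imp_coprime[of "int p" "2 * y"] cong_mult_lcancel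
      by (metis coprime_commute prime_nat_int_transfer)
  qed
  show "[2 * y * F = - (x + y)] (mod int p)" if "3 dvd y - x"
  proof -
    have "om (\<omega>\<^sup>2 * ?A) = - (x + y)" by (simp add: power2_eq_square)
    then show ?thesis using fib[OF symbol(2)[OF that, unfolded omega_symbol_square_values]] by simp
  qed
qed

section \<open>Reduction of the binomial sums to Fibonacci numbers\<close>

definition morgan_voyce_b :: "nat \<Rightarrow> 'a::comm_semiring_1 \<Rightarrow> 'a" where
  "morgan_voyce_b n z = (\<Sum>k\<le>n. of_nat ((n + k) choose (2 * k)) * z ^ k)"

definition morgan_voyce_B :: "nat \<Rightarrow> 'a::comm_semiring_1 \<Rightarrow> 'a" where
  "morgan_voyce_B n z = (\<Sum>k\<le>n. of_nat ((n + k + 1) choose (2 * k + 1)) * z ^ k)"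

lemma morgan_voyce_0 [simp]: "morgan_voyce_b 0 z = 1" "morgan_voyce_B 0 z = 1"
  by (simp_all add: morgan_voyce_b_def morgan_voyce_B_def)

lemma morgan_voyce_b_Suc: "morgan_voyce_b (Suc n) z = morgan_voyce_b n z + z * morgan_voyce_B n z"
proof -
  let ?b = "\<lambda>k. of_nat ((n + k) choose (2 * k)) * z ^ k"
  have "morgan_voyce_b (Suc n) z = 1 + (\<Sum>k\<le>n. of_nat ((n + k + 2) choose (2 * k + 2)) * z ^ Suc k)"
    unfolding morgan_voyce_b_def by (subst sum.atMost_Suc_shift) simp
  also have "(\<Sum>k\<le>n. of_nat ((n + k + 2) choose (2 * k + 2)) * z ^ Suc k)
      = (\<Sum>k\<le>n. ?b (Suc k)) + z * morgan_voyce_B n z"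
    unfolding morgan_voyce_B_def sum_distrib_left sum.distrib[symmetric]
    by (intro sum.cong refl) (simp add: algebra_simps)
  also have "1 + ((\<Sum>k\<le>n. ?b (Suc k)) + z * morgan_voyce_B n z)
      = (\<Sum>k\<le>Suc n. ?b k) + z * morgan_voyce_B n z"
    by (subst sum.atMost_Suc_shift) (simp add: add.assoc)
  also have "\<dots> = morgan_voyce_b n z + z * morgan_voyce_B n z"
    by (simp add: morgan_voyce_b_def binomial_eq_0)
  finally show ?thesis .
qed

lemma morgan_voyce_B_Suc: "morgan_voyce_B (Suc n) z = morgan_voyce_B n z + morgan_voyce_b (Suc n) z"
proof -
  let ?B = "\<lambda>k. of_nat ((n + k + 1) choose (2 * k + 1)) * z ^ k"
  have "morgan_voyce_B (Suc n) z = (\<Sum>k\<le>Suc n. ?B k) + morgan_voyce_b (Suc n) z"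
    unfolding morgan_voyce_B_def morgan_voyce_b_def sum.distrib[symmetric]
    by (intro sum.cong refl) (simp add: algebra_simps)
  also have "(\<Sum>k\<le>Suc n. ?B k) = morgan_voyce_B n z"
    by (simp add: morgan_voyce_B_def binomial_eq_0)
  finally show ?thesis .
qed

lemma morgan_voyce_1:
  "morgan_voyce_b n (1 :: 'a::comm_semiring_1) = of_nat (fib (2 * n + 1))"
  "morgan_voyce_B n (1 :: 'a) = of_nat (fib (2 * n + 2))"
  by (induction n) (simp_all add: morgan_voyce_b_Suc morgan_voyce_B_Suc add_ac)

lemma morgan_voyce_b_minus_1_add_6:
  fixes n :: nat
  shows "morgan_voyce_b (n + 6) (- 1) = (morgan_voyce_b n (- 1) :: 'a::comm_ring_1)"
  by (simp add: eval_nat_numeral morgan_voyce_b_Suc morgan_voyce_B_Suc)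

lemma morgan_voyce_b_minus_1_mod_6:
  "morgan_voyce_b n (- 1 :: 'a::comm_ring_1) = morgan_voyce_b (n mod 6) (- 1)"
proof -
  have "morgan_voyce_b (m + 6 * k) (- 1 :: 'a) = morgan_voyce_b m (- 1)" for m k
  proof (induction k)
    case (Suc k)
    then show ?case
      using morgan_voyce_b_minus_1_add_6[of "m + 6 * k", where 'a = 'a] by (simp add: algebra_simps)
  qed simp
  from this[of "n mod 6" "n div 6"] show ?thesis by simp
qed

lemma morgan_voyce_b_minus_1_values:
  "morgan_voyce_b (Suc 0) (- 1 :: int) = 0" "morgan_voyce_b 2 (- 1 :: int) = - 1"
  "morgan_voyce_b 3 (- 1 :: int) = - 1" "morgan_voyce_b 4 (- 1 :: int) = 0"
  "morgan_voyce_b 5 (- 1 :: int) = 1"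
  by (simp_all add: eval_nat_numeral morgan_voyce_b_Suc morgan_voyce_B_Suc)

lemma morgan_voyce_b_minus_1_eq_eps:
  assumes "odd p" "\<not> 3 dvd p"
  shows "morgan_voyce_b (p div 3) (- 1) = eps p"
proof -
  define d m where "d = p mod 18" and "m = p div 18"
  have p: "p = d + 18 * m" by (simp add: d_def m_def)
  have "d < 18" "odd d" "\<not> 3 dvd d" using assms by (simp_all add: d_def dvd_mod_iff)
  then have d: "d \<in> {1, 5, 7, 11, 13, 17}"
    by (auto simp: numeral_eq_Suc less_Suc_eq elim!: oddE) presburger+
  have "p div 3 = d div 3 + 6 * m" using p by presburger
  then have index: "p div 3 mod 6 = d div 3" using \<open>d < 18\<close> by simp
  have "int p = int d + 9 * (2 * int m)" using p by simp
  then have residue: "int p mod 9 = int d mod 9" by presburger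
  show ?thesis
    using d unfolding eps_def cong_def residue morgan_voyce_b_minus_1_mod_6[of "p div 3"] index
    by (elim insertE) (simp_all add: morgan_voyce_b_minus_1_values)
qed

lemma double_sum_even_indices:
  fixes f :: "nat \<Rightarrow> 'a::comm_ring_1"
  shows "2 * (\<Sum>k\<le>n div 2. f (2 * k)) = (\<Sum>k\<le>n. f k) + (\<Sum>k\<le>n. f k * (- 1) ^ k)"
proof (induction n)
  case (Suc n)
  show ?case
  proof (cases "even n")
    case True
    then show ?thesis using Suc.IH by simp
  next
    case False
    then have "Suc n div 2 = Suc (n div 2)" "2 * Suc (n div 2) = Suc n" by (auto elim!: oddE)
    then show ?thesis using Suc.IH False by (simp add: algebra_simps)
  qed
qed simp

lemma choose_double_rec:
  "((n + Suc k) choose (2 * Suc k)) * ((2 * k + 1) * (2 * k + 2))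
    = ((n + k) choose (2 * k)) * ((n + k + 1) * (n - k))"
proof -
  have "((n + Suc k) choose (2 * Suc k)) * (2 * k + 2) = ((n + k) choose (2 * k + 1)) * (n + k + 1)"
    using Suc_times_binomial_eq[of "n + k" "2 * k + 1"] by (simp add: mult.commute)
  moreover have "((n + k) choose (2 * k + 1)) * (2 * k + 1) = ((n + k) choose (2 * k)) * (n - k)"
    using binomial_absorption[of "2 * k" "n + k"] binomial_absorb_comp[of "n + k" "2 * k"]
    by (simp add: mult.commute)
  ultimately show ?thesis by (metis mult.assoc mult.commute)
qed

lemma choose_triple_rec:
  "((3 * Suc k) choose Suc k) * ((2 * k + 1) * (2 * k + 2))
    = ((3 * k) choose k) * (3 * ((3 * k + 1) * (3 * k + 2)))"
proof -
  have fact_expand: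
    "fact (3 * Suc k) = (3 * (k + 1)) * (3 * k + 2) * (3 * k + 1) * (fact (3 * k) :: nat)"
    "fact (2 * Suc k) = (2 * k + 2) * (2 * k + 1) * (fact (2 * k) :: nat)"
    by (simp_all add: eval_nat_numeral algebra_simps)
  have "fact (Suc k) * fact (2 * Suc k) * ((3 * Suc k) choose Suc k) = (fact (3 * Suc k) :: nat)"
    using binomial_fact_lemma[of "Suc k" "3 * Suc k"] by (simp del: fact_Suc)
  moreover have "fact k * fact (2 * k) * ((3 * k) choose k) = (fact (3 * k) :: nat)"
    using binomial_fact_lemma[of k "3 * k"] by simp
  ultimately have "((k + 1) * (fact k * fact (2 * k)))
        * (((3 * Suc k) choose Suc k) * ((2 * k + 1) * (2 * k + 2)))
      = ((k + 1) * (fact k * fact (2 * k)))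
        * (((3 * k) choose k) * (3 * ((3 * k + 1) * (3 * k + 2))))"
    unfolding fact_expand by (simp add: algebra_simps)
  then show ?thesis by simp
qed

text \<open>The factors by which the two binomial coefficients grow with \<open>k\<close> agree modulo \<open>p\<close>.\<close>

lemma choose_rec_factors_cong:
  fixes n k p :: int
  assumes "p = 3 * n + 1 \<or> p = 3 * n + 2"
  shows "[- 27 * ((n + k + 1) * (n - k)) = 3 * ((3 * k + 1) * (3 * k + 2))] (mod p)"
proof -
  have "- 27 * ((n + k + 1) * (n - k)) - 3 * ((3 * k + 1) * (3 * k + 2))
      = - 3 * ((3 * n + 1) * (3 * n + 2))"
    by (simp add: algebra_simps)
  then show ?thesis using assms by (auto simp: cong_iff_dvd_diff)
qed

lemma choose_double_cong_choose_triple: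
  assumes "prime p" "p \<noteq> 3" "k \<le> p div 3"
  shows "[(- 27) ^ k * int ((p div 3 + k) choose (2 * k)) = int ((3 * k) choose k)] (mod int p)"
  using assms(3)
proof (induction k)
  case (Suc k)
  define n where "n = p div 3"
  have k: "k < n" using Suc.prems by (simp add: n_def)
  have IH: "[(- 27) ^ k * int ((n + k) choose (2 * k)) = int ((3 * k) choose k)] (mod int p)"
    using Suc by (simp add: n_def)
  let ?d = "int ((2 * k + 1) * (2 * k + 2))" and ?u = "(int n + int k + 1) * (int n - int k)"
  have "coprime ((2 * k + 1) * (2 * k + 2)) p"
  proof -
    have "2 * k + 2 < p" using k unfolding n_def by presburger
    then have "\<not> p dvd 2 * k + 1" "\<not> p dvd 2 * k + 2" by (auto dest: dvd_imp_le)
    then have "coprime p (2 * k + 1)" "coprime p (2 * k + 2)"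
      using assms(1) prime_imp_coprime by blast+
    then show ?thesis by (simp only: coprime_mult_left_iff coprime_commute[of p])
  qed
  then have coprime: "coprime ?d (int p)" by (simp only: coprime_int_iff)
  have double: "int ((n + Suc k) choose (2 * Suc k)) * ?d = int ((n + k) choose (2 * k)) * ?u"
    using arg_cong[OF choose_double_rec, of int n k] k
    by (simp only: of_nat_mult of_nat_add of_nat_diff) simp
  have triple: "int ((3 * Suc k) choose Suc k) * ?d
      = int ((3 * k) choose k) * (3 * ((3 * int k + 1) * (3 * int k + 2)))"
    using arg_cong[OF choose_triple_rec[of k], of int] by (simp only: of_nat_mult of_nat_add) simp
  have "p = 3 * n + 1 \<or> p = 3 * n + 2"
    using prime_mod_3[OF assms(1,2)] unfolding n_def by presburger
  then have "int p = 3 * int n + 1 \<or> int p = 3 * int n + 2" by auto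
  note factors = choose_rec_factors_cong[OF this, of "int k"]
  have "(- 27) ^ Suc k * int ((n + Suc k) choose (2 * Suc k)) * ?d
      = (- 27) ^ k * int ((n + k) choose (2 * k)) * (- 27 * ?u)"
    using double by (simp only: power_Suc mult_ac)
  also have "[\<dots> = int ((3 * Suc k) choose Suc k) * ?d] (mod int p)"
    unfolding triple by (intro cong_mult IH factors)
  finally show ?case using coprime unfolding n_def by (simp only: cong_mult_rcancel)
qed simp

lemma quot_mod_cong:
  assumes "coprime b (int p)" "[b * c = a] (mod int p)"
  shows "[quot_mod p a b = c] (mod int p)"
proof -
  have "[a * modular_inverse (int p) b = b * c * modular_inverse (int p) b] (mod int p)"
    by (intro cong_mult cong_refl cong_sym[OF assms(2)])
  also have "b * c * modular_inverse (int p) b = b * modular_inverse (int p) b * c"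
    by (simp only: mult_ac)
  also have "[\<dots> = 1 * c] (mod int p)"
    using assms(1) by (intro cong_mult cong_refl cong_modular_inverse1)
  finally show ?thesis by (simp add: quot_mod_def)
qed

lemma sum_choose_triple_cong_fib:
  assumes "prime p" "p > 5"
  shows "[(\<Sum>k = 0..p div 3. quot_mod p (int ((3 * k) choose k)) ((- 27) ^ k))
    = int (fib (2 * (p div 3) + 1))] (mod int p)"
proof -
  have "[(\<Sum>k = 0..p div 3. quot_mod p (int ((3 * k) choose k)) ((- 27) ^ k))
      = (\<Sum>k = 0..p div 3. int ((p div 3 + k) choose (2 * k)))] (mod int p)"
    using assms coprime_denominator_sums[OF assms]
    by (intro cong_sum quot_mod_cong choose_double_cong_choose_triple) auto
  also have "(\<Sum>k = 0..p div 3. int ((p div 3 + k) choose (2 * k))) = morgan_voyce_b (p div 3) 1"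
    by (simp add: morgan_voyce_b_def atLeast0AtMost)
  finally show ?thesis by (simp only: morgan_voyce_1)
qed

lemma sum_choose_sextuple_cong_fib:
  assumes "prime p" "p > 5"
  shows "[2 * (\<Sum>k = 0..p div 6. quot_mod p (int ((6 * k) choose (2 * k))) (27 ^ (2 * k)))
    = int (fib (2 * (p div 3) + 1)) + eps p] (mod int p)"
proof -
  define n where "n = p div 3"
  let ?c = "\<lambda>k. int ((n + k) choose (2 * k))"
  have half: "p div 6 = n div 2" unfolding n_def by simp
  have "[quot_mod p (int ((6 * k) choose (2 * k))) (27 ^ (2 * k)) = ?c (2 * k)] (mod int p)"
    if "k \<le> n div 2" for k
  proof (rule quot_mod_cong[OF coprime_denominator_sums(1)[OF assms]])
    have "2 * k \<le> p div 3" using that unfolding n_def by presburger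
    then show "[27 ^ (2 * k) * ?c (2 * k) = int ((6 * k) choose (2 * k))] (mod int p)"
      using choose_double_cong_choose_triple[of p "2 * k"] assms by (simp add: n_def)
  qed
  then have "[2 * (\<Sum>k = 0..p div 6. quot_mod p (int ((6 * k) choose (2 * k))) (27 ^ (2 * k)))
      = 2 * (\<Sum>k\<le>n div 2. ?c (2 * k))] (mod int p)"
    unfolding half atLeast0AtMost by (intro cong_scalar_left cong_sum) simp
  also have "2 * (\<Sum>k\<le>n div 2. ?c (2 * k)) = morgan_voyce_b n 1 + morgan_voyce_b n (- 1)"
    unfolding double_sum_even_indices[of ?c] by (simp add: morgan_voyce_b_def)
  also have "morgan_voyce_b n (- 1) = eps p"
    unfolding n_def
    using assms prime_odd_nat[of p] primes_dvd_imp_eq[of 3 p]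
    by (intro morgan_voyce_b_minus_1_eq_eps) auto
  finally show ?thesis by (simp only: morgan_voyce_1 n_def)
qed

lemma sum_choose_sextuple_cong_sum_choose_triple:
  assumes "prime p" "p > 5"
  shows "[2 * (\<Sum>k = 0..p div 6. quot_mod p (int ((6 * k) choose (2 * k))) (27 ^ (2 * k))) - eps p
    = (\<Sum>k = 0..p div 3. quot_mod p (int ((3 * k) choose k)) ((- 27) ^ k))] (mod int p)"
  using cong_diff[OF sum_choose_sextuple_cong_fib[OF assms] cong_refl, of "eps p"]
    sum_choose_triple_cong_fib[OF assms]
  by (simp add: cong_def)

lemma sum_choose_triple_cong_quot_mod:
  assumes "prime p" "p > 5" "coprime d (int p)"
    and "[d * int (fib (2 * (p div 3) + 1)) = a] (mod int p)"
  shows "[(\<Sum>k = 0..p div 3. quot_mod p (int ((3 * k) choose k)) ((- 27) ^ k))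
    = quot_mod p a d] (mod int p)"
  using sum_choose_triple_cong_fib[OF assms(1,2)] quot_mod_cong[OF assms(3,4)]
  by (simp add: cong_def)

section \<open>Representation of primes by forms of discriminant -60\<close>

lemma QuadRes_iff_residue:
  assumes "n > 0"
  shows "QuadRes n a \<longleftrightarrow> (\<exists>y\<in>{0..<n}. y\<^sup>2 mod n = a mod n)"
proof
  assume "QuadRes n a"
  then obtain y where "y\<^sup>2 mod n = a mod n" unfolding QuadRes_def cong_def by blast
  then have "(y mod n)\<^sup>2 mod n = a mod n" by (simp add: power_mod)
  then show "\<exists>y\<in>{0..<n}. y\<^sup>2 mod n = a mod n" using assms by (intro bexI[of _ "y mod n"]) simp_all
qed (auto simp: QuadRes_def cong_def)

lemma Legendre_3: "Legendre a 3 = (if a mod 3 = 0 then 0 else if a mod 3 = 1 then 1 else - 1)"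
proof -
  have "{0..<3} = {0, 1, 2 :: int}" by auto
  then have "QuadRes 3 a \<longleftrightarrow> a mod 3 = 0 \<or> a mod 3 = 1" by (auto simp: QuadRes_iff_residue)
  then show ?thesis by (auto simp: Legendre_def cong_def)
qed

lemma Legendre_5:
  "Legendre a 5 = (if a mod 5 = 0 then 0 else if a mod 5 = 1 \<or> a mod 5 = 4 then 1 else - 1)"
proof -
  have "{0..<5} = {0, 1, 2, 3, 4 :: int}" by auto
  then have "QuadRes 5 a \<longleftrightarrow> a mod 5 = 0 \<or> a mod 5 = 1 \<or> a mod 5 = 4"
    by (auto simp: QuadRes_iff_residue)
  then show ?thesis by (auto simp: Legendre_def cong_def)
qed

lemma Legendre_eqI:
  assumes "prime p" "p > 2" "[a ^ ((p - 1) div 2) = s] (mod int p)" "\<bar>s\<bar> \<le> 1"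
  shows "Legendre a (int p) = s"
proof -
  have "[Legendre a (int p) = s] (mod int p)"
    using euler_criterion[OF assms(1,2)] assms(3) by (rule cong_trans)
  then have dvd: "int p dvd \<bar>Legendre a (int p) - s\<bar>" by (simp add: cong_iff_dvd_diff)
  have "\<bar>Legendre a (int p)\<bar> \<le> 1" by (simp add: Legendre_def)
  then have "\<bar>Legendre a (int p) - s\<bar> < int p" using assms(2,4) by linarith
  then have "\<not> 0 < \<bar>Legendre a (int p) - s\<bar>" using dvd zdvd_not_zless by blast
  then show ?thesis by simp
qed

lemma Legendre_minus_1:
  assumes "prime p" "p > 2"
  shows "Legendre (- 1) (int p) = (- 1) ^ ((p - 1) div 2)"
  using assms by (intro Legendre_eqI) simp_all

lemma Legendre_mult:
  assumes "prime p" "p > 2"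
  shows "Legendre (a * b) (int p) = Legendre a (int p) * Legendre b (int p)"
proof (rule Legendre_eqI[OF assms])
  show "[(a * b) ^ ((p - 1) div 2) = Legendre a (int p) * Legendre b (int p)] (mod int p)"
    unfolding power_mult_distrib by (intro cong_mult cong_sym[OF euler_criterion] assms)
  show "\<bar>Legendre a (int p) * Legendre b (int p)\<bar> \<le> 1" by (simp add: Legendre_def)
qed

lemma Legendre_minus_15:
  assumes "prime p" "p > 5"
  shows "Legendre (- 15) (int p) = Legendre (int p) 3 * Legendre (int p) 5"
proof -
  let ?s = "(- 1 :: int) ^ ((p - 1) div 2)"
  have p: "2 < p" using assms(2) by simp
  have "Legendre (- 1 * 3 * 5) (int p) = ?s * Legendre 3 (int p) * Legendre 5 (int p)"
    by (simp only: Legendre_mult[OF assms(1) p] Legendre_minus_1[OF assms(1) p])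
  moreover have "Legendre (int p) 3 * Legendre 3 (int p) = ?s"
    using Quadratic_Reciprocity[OF assms(1) p, of 3] assms(2) by simp
  moreover have "Legendre (int p) 5 * Legendre 5 (int p) = 1"
    using Quadratic_Reciprocity[OF assms(1) p, of 5] assms(2) by (simp add: power_mult mult.commute)
  moreover have "Legendre 3 (int p) \<in> {- 1, 0, 1}" "Legendre 5 (int p) \<in> {- 1, 0, 1}"
    by (simp_all add: Legendre_def)
  ultimately show ?thesis by auto
qed

lemma minus_15_square_root:
  assumes "prime p" "p > 5" "p mod 15 \<in> {1, 2, 4, 8}"
  obtains t where "int p dvd t\<^sup>2 + 15"
proof -
  have mods: "int p mod 3 = int (p mod 15 mod 3)" "int p mod 5 = int (p mod 15 mod 5)"
    by (simp_all add: mod_mod_cancel zmod_int)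
  have "Legendre (- 15) (int p) = 1"
    unfolding Legendre_minus_15[OF assms(1,2)] Legendre_3 Legendre_5 mods
    using assms(3) by (elim insertE) simp_all
  then have "QuadRes (int p) (- 15)" by (auto simp: Legendre_def split: if_splits)
  then show ?thesis using that by (auto simp: QuadRes_def cong_iff_dvd_diff)
qed

lemma thue:
  fixes t :: int
  assumes "n > 0" "n < (a + 1) * (b + 1)"
  obtains u v where "u \<noteq> 0 \<or> v \<noteq> 0" "\<bar>u\<bar> \<le> int a" "\<bar>v\<bar> \<le> int b" "int n dvd u - t * v"
proof -
  define S where "S = {0..int a} \<times> {0..int b}"
  define f where "f = (\<lambda>(u, v). (u - t * v) mod int n)"
  have "f ` S \<subseteq> {0..<int n}" using assms(1) by (auto simp: f_def)
  then have "card (f ` S) \<le> n" using card_mono[of "{0..<int n}" "f ` S"] by simp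
  also have "n < card S" using assms(2) by (simp add: S_def card_cartesian_product nat_add_distrib)
  finally have "\<not> inj_on f S" by (rule pigeonhole)
  then obtain u v u' v' where uv:
    "(u, v) \<in> S" "(u', v') \<in> S" "f (u, v) = f (u', v')" "(u, v) \<noteq> (u', v')"
    unfolding inj_on_def by auto
  show ?thesis
  proof (rule that[of "u - u'" "v - v'"])
    show "u - u' \<noteq> 0 \<or> v - v' \<noteq> 0" using uv(4) by auto
    show "\<bar>u - u'\<bar> \<le> int a" "\<bar>v - v'\<bar> \<le> int b" using uv(1,2) by (auto simp: S_def)
    have "int n dvd (u - t * v) - (u' - t * v')" using uv(3) by (simp add: f_def mod_eq_dvd_iff)
    then show "int n dvd u - u' - t * (v - v')" by (simp add: algebra_simps)
  qed
qed

text \<open>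
  The box \<open>\<bar>u\<bar> < 2 \<surd>p\<close>, \<open>\<bar>v\<bar> \<le> \<surd>p / 2\<close> is chosen to make the bound on \<open>k\<close> close to its optimum
  \<open>2 \<surd>15\<close>.
\<close>

lemma small_multiple:
  assumes "p > 0" "int p dvd t\<^sup>2 + 15"
  obtains u v k :: int where "u\<^sup>2 + 15 * v\<^sup>2 = k * int p" "k \<in> {1..7}"
proof -
  define b where "b = floor_sqrt (p div 4)"
  define a where "a = p div (b + 1)"
  have "b\<^sup>2 \<le> p div 4" "p div 4 < (b + 1)\<^sup>2"
    using Suc_floor_sqrt_power2_gt[of "p div 4"] by (simp_all add: b_def)
  then have b_bounds: "4 * b\<^sup>2 \<le> p" "p < 4 * (b + 1)\<^sup>2" by linarith+
  have "a * (b + 1) \<le> p" unfolding a_def by (rule div_times_less_eq_dividend)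
  then have "(a * (b + 1))\<^sup>2 \<le> p\<^sup>2" by (rule power_mono) simp
  then have "a\<^sup>2 * (b + 1)\<^sup>2 \<le> p * p" by (simp only: power_mult_distrib power2_eq_square[of p])
  also have "\<dots> < p * (4 * (b + 1)\<^sup>2)" using b_bounds(2) assms(1) by simp
  finally have a_bound: "a\<^sup>2 < 4 * p" by (simp add: mult.assoc[symmetric] mult.commute[of p])
  have "p < (a + 1) * (b + 1)" using dividend_less_div_times[of "b + 1" p] by (simp add: a_def)
  then obtain u v where uv: "u \<noteq> 0 \<or> v \<noteq> 0" "\<bar>u\<bar> \<le> int a" "\<bar>v\<bar> \<le> int b" "int p dvd u - t * v"
    using thue[OF assms(1)] by blast
  have "int p dvd (u - t * v) * (u + t * v) + (t\<^sup>2 + 15) * v\<^sup>2"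
    using assms(2) uv(4) by (intro dvd_add[OF dvd_mult2 dvd_mult2])
  also have "\<dots> = u\<^sup>2 + 15 * v\<^sup>2" by (simp add: power2_eq_square algebra_simps)
  finally obtain k where k: "u\<^sup>2 + 15 * v\<^sup>2 = int p * k" by (rule dvdE)
  have "u\<^sup>2 \<le> int (a\<^sup>2)" "v\<^sup>2 \<le> int (b\<^sup>2)"
    using uv(2,3) by (simp_all add: abs_le_square_iff[symmetric])
  then have "int p * k < int p * 8" using a_bound b_bounds(1) k by linarith
  moreover have "int p * k > 0"
    unfolding k[symmetric]
    using uv(1) zero_le_power2[of u] zero_le_power2[of v] zero_less_power2[of u]
    zero_less_power2[of v]
    by linarith
  ultimately have "k \<in> {1..7}" using assms(1) by (simp add: zero_less_mult_iff)
  then show ?thesis using that[of u v k] k by (simp add: mult.commute)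
qed

lemma odd_square_cong_1_mod_8:
  assumes "odd (u :: int)"
  shows "[u\<^sup>2 = 1] (mod 8)"
proof -
  have "odd (nat \<bar>u\<bar>)" using assms by (simp add: even_nat_iff)
  then have "[(nat \<bar>u\<bar>)\<^sup>2 = 1] (mod 8)" unfolding square_mod_8_eq_1_iff .
  then have "[int ((nat \<bar>u\<bar>)\<^sup>2) = int 1] (mod int 8)" by (simp only: cong_int_iff)
  then show ?thesis by simp
qed

lemma even_form_cases:
  fixes a b u v :: int
  assumes "odd a" "odd b" "8 dvd a + b" "even (a * u\<^sup>2 + b * v\<^sup>2)"
  obtains c d where "u = 2 * c" "v = 2 * d" | "8 dvd a * u\<^sup>2 + b * v\<^sup>2"
proof (cases "even u")
  case True
  moreover from this have "even v" using assms by simp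
  ultimately show ?thesis using that(1) by (auto elim!: evenE)
next
  case False
  then have "odd v" using assms by simp
  with False have "[a * u\<^sup>2 + b * v\<^sup>2 = a * 1 + b * 1] (mod 8)"
    by (intro cong_add cong_mult cong_refl odd_square_cong_1_mod_8)
  then show ?thesis using that(2) assms(3) cong_dvd_iff by fastforce
qed

lemma form_not_twice_odd:
  fixes a b u v q :: int
  assumes "odd a" "odd b" "8 dvd a + b" "odd q"
  shows "a * u\<^sup>2 + b * v\<^sup>2 \<noteq> 2 * q"
proof
  assume form: "a * u\<^sup>2 + b * v\<^sup>2 = 2 * q"
  then have "even (a * u\<^sup>2 + b * v\<^sup>2)" by simp
  from assms(1-3) this show False
  proof (cases rule: even_form_cases)
    case (1 c d)
    then have "2 * q = 4 * (a * c\<^sup>2 + b * d\<^sup>2)"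
      unfolding form[symmetric] by (simp add: power2_eq_square algebra_simps)
    then show False using assms(4) by presburger
  next
    case 2
    then show False using assms(4) unfolding form by presburger
  qed
qed

lemma form_four_times_odd:
  fixes a b u v q :: int
  assumes "odd a" "odd b" "8 dvd a + b" "odd q" and form: "a * u\<^sup>2 + b * v\<^sup>2 = 4 * q"
  obtains c d where "a * c\<^sup>2 + b * d\<^sup>2 = q"
proof -
  have "even (a * u\<^sup>2 + b * v\<^sup>2)" by (simp add: form)
  from assms(1-3) this show ?thesis
  proof (cases rule: even_form_cases)
    case (1 c d)
    then have "4 * q = 4 * (a * c\<^sup>2 + b * d\<^sup>2)"
      unfolding form[symmetric] by (simp add: power2_eq_square algebra_simps)
    then have "a * c\<^sup>2 + b * d\<^sup>2 = q" by simp
    then show ?thesis by (rule that)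
  next
    case 2
    then show ?thesis using assms(4) unfolding form by presburger
  qed
qed

lemma prime_dvd_square_add_multiple:
  fixes q u m n :: int
  assumes "prime q" "u\<^sup>2 + m = n" "q dvd m" "q dvd n"
  obtains a where "u = q * a"
proof -
  have "q dvd n - m" using assms(4,3) by (rule dvd_diff)
  also have "n - m = u\<^sup>2" using assms(2) by simp
  finally have "q dvd u" using assms(1) prime_dvd_power by blast
  then show ?thesis using that by (auto simp: dvd_def)
qed

lemma square_mod_15: "(u :: int)\<^sup>2 mod 15 \<in> {0, 1, 4, 6, 9, 10}"
proof -
  have "u mod 15 \<in> {0..<15}" by simp
  also have "{0..<15} = {0, 1, 2, 3, 4, 5, 6, 7, 8, 9, 10, 11, 12, 13, 14 :: int}"
    by auto presburger
  finally have "(u mod 15)\<^sup>2 mod 15 \<in> {0, 1, 4, 6, 9, 10}" by (elim insertE) simp_all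
  then show ?thesis by (simp add: power_mod)
qed

lemma multiplier_mod_15:
  fixes k :: int
  assumes "u\<^sup>2 + 15 * v\<^sup>2 = k * int p" "k \<in> {1..7}"
  shows "p mod 15 \<in> {1, 4} \<Longrightarrow> k \<in> {1, 4, 6}" and "p mod 15 \<in> {2, 8} \<Longrightarrow> k \<in> {2, 3, 5}"
proof -
  have "(k * int (p mod 15)) mod 15 = (u\<^sup>2 + 15 * v\<^sup>2) mod 15"
    unfolding assms(1) by (simp add: zmod_int mod_mult_right_eq)
  then have residue: "(k * int (p mod 15)) mod 15 \<in> {0, 1, 4, 6, 9, 10}"
    using square_mod_15[of u] by simp
  have "{1..7} = {1, 2, 3, 4, 5, 6, 7 :: int}" by auto
  then have "k \<in> {1, 2, 3, 4, 5, 6, 7}" using assms(2) by simp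
  then show "p mod 15 \<in> {1, 4} \<Longrightarrow> k \<in> {1, 4, 6}" and "p mod 15 \<in> {2, 8} \<Longrightarrow> k \<in> {2, 3, 5}"
    using residue by (elim insertE; force)+
qed

lemma prime_eq_x2_15y2:
  assumes "prime p" "p > 5" "p mod 15 \<in> {1, 4}"
  shows "\<exists>x y :: int. int p = x\<^sup>2 + 15 * y\<^sup>2"
proof -
  have odd: "odd (int p)" using assms(1,2) prime_odd_nat[of p] by simp
  obtain t where "int p dvd t\<^sup>2 + 15" using minus_15_square_root assms by blast
  then obtain u v k where uv: "u\<^sup>2 + 15 * v\<^sup>2 = k * int p" "k \<in> {1..7}"
    using small_multiple assms(2) by (metis less_trans zero_less_numeral)
  consider "k = 1" | "k = 4" | "k = 6" using multiplier_mod_15(1)[OF uv assms(3)] by auto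
  then show ?thesis
  proof cases
    case 1
    then show ?thesis using uv(1) by (metis mult_1)
  next
    case 2
    then obtain c d where "1 * c\<^sup>2 + 15 * d\<^sup>2 = int p"
      using form_four_times_odd[of 1 15 "int p" u v] uv(1) odd by auto
    then show ?thesis by (metis mult_1)
  next
    case 3
    then obtain a where "u = 3 * a" using prime_dvd_square_add_multiple[OF _ uv(1), of 3] by auto
    then have "3 * a\<^sup>2 + 5 * v\<^sup>2 = 2 * int p" using uv(1) 3 by (simp add: power_mult_distrib)
    then show ?thesis using form_not_twice_odd[of 3 5 "int p" a v] odd by simp
  qed
qed

lemma prime_eq_5x2_3y2:
  assumes "prime p" "p > 5" "p mod 15 \<in> {2, 8}"
  shows "\<exists>x y :: int. int p = 5 * x\<^sup>2 + 3 * y\<^sup>2"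
proof -
  have odd: "odd (int p)" using assms(1,2) prime_odd_nat[of p] by simp
  obtain t where "int p dvd t\<^sup>2 + 15" using minus_15_square_root assms by blast
  then obtain u v k where uv: "u\<^sup>2 + 15 * v\<^sup>2 = k * int p" "k \<in> {1..7}"
    using small_multiple assms(2) by (metis less_trans zero_less_numeral)
  consider "k = 2" | "k = 3" | "k = 5" using multiplier_mod_15(2)[OF uv assms(3)] by auto
  then show ?thesis
  proof cases
    case 1
    then show ?thesis using form_not_twice_odd[of 1 15 "int p" u v] uv(1) odd by simp
  next
    case 2
    then obtain a where "u = 3 * a" using prime_dvd_square_add_multiple[OF _ uv(1), of 3] by auto
    then have "int p = 5 * v\<^sup>2 + 3 * a\<^sup>2" using uv(1) 2 by (simp add: power_mult_distrib)
    then show ?thesis by blast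
  next
    case 3
    then obtain a where "u = 5 * a" using prime_dvd_square_add_multiple[OF _ uv(1), of 5] by auto
    then have "int p = 5 * a\<^sup>2 + 3 * v\<^sup>2" using uv(1) 3 by (simp add: power_mult_distrib)
    then show ?thesis by blast
  qed
qed

theorem theorem3p4:
  fixes p :: nat
  assumes "prime p" and "p > 5"
  shows
    "([p = 1] (mod 15) \<or> [p = 4] (mod 15) \<longrightarrow>
        (\<exists>x y :: int. int p = x^2 + 15 * y^2) \<and>
        [2 * (\<Sum>k = 0..p div 6. quot_mod p (int ((6 * k) choose (2 * k))) (27 ^ (2 * k))) - eps p
          = (\<Sum>k = 0..p div 3. quot_mod p (int ((3 * k) choose k)) ((- 27) ^ k))] (mod int p) \<and>
        (\<forall>x y :: int. int p = x^2 + 15 * y^2 \<longrightarrow>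
          (3 dvd y \<longrightarrow>
            [(\<Sum>k = 0..p div 3. quot_mod p (int ((3 * k) choose k)) ((- 27) ^ k))
              = 1] (mod int p)) \<and>
          (3 dvd y - x \<longrightarrow>
            [(\<Sum>k = 0..p div 3. quot_mod p (int ((3 * k) choose k)) ((- 27) ^ k))
              = quot_mod p (x - 5 * y) (10 * y)] (mod int p))))
     \<and>
     ([p = 2] (mod 15) \<or> [p = 8] (mod 15) \<longrightarrow>
        (\<exists>x y :: int. int p = 5 * x^2 + 3 * y^2) \<and>
        [2 * (\<Sum>k = 0..p div 6. quot_mod p (int ((6 * k) choose (2 * k))) (27 ^ (2 * k))) - eps p
          = (\<Sum>k = 0..p div 3. quot_mod p (int ((3 * k) choose k)) ((- 27) ^ k))] (mod int p) \<and>
        (\<forall>x y :: int. int p = 5 * x^2 + 3 * y^2 \<longrightarrow>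
          (3 dvd y \<longrightarrow>
            [(\<Sum>k = 0..p div 3. quot_mod p (int ((3 * k) choose k)) ((- 27) ^ k))
              = 1] (mod int p)) \<and>
          (3 dvd y - x \<longrightarrow>
            [(\<Sum>k = 0..p div 3. quot_mod p (int ((3 * k) choose k)) ((- 27) ^ k))
              = quot_mod p (- (x + y)) (2 * y)] (mod int p))))"
proof -
  let ?S = "\<Sum>k = 0..p div 3. quot_mod p (int ((3 * k) choose k)) ((- 27) ^ k)"
  note S = sum_choose_triple_cong_fib[OF assms]
  have "\<exists>x y :: int. int p = x^2 + 15 * y^2" if "[p = 1] (mod 15) \<or> [p = 4] (mod 15)"
    using that assms by (intro prime_eq_x2_15y2) (auto simp: cong_def)
  moreover have "[?S = 1] (mod int p)" if "int p = x^2 + 15 * y^2" "3 dvd y" for x y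
    by (rule cong_trans[OF S fib_cong_x2_15y2(1)[OF assms that]])
  moreover have "[?S = quot_mod p (x - 5 * y) (10 * y)] (mod int p)"
    if "int p = x^2 + 15 * y^2" "3 dvd y - x" for x y
    using coprime_denominator_form(2)[OF assms, of 1 x 15 y] that(1)
    by (intro sum_choose_triple_cong_quot_mod assms fib_cong_x2_15y2(2)[OF assms that]) simp
  moreover have "\<exists>x y :: int. int p = 5 * x^2 + 3 * y^2" if "[p = 2] (mod 15) \<or> [p = 8] (mod 15)"
    using that assms by (intro prime_eq_5x2_3y2) (auto simp: cong_def)
  moreover have "[?S = 1] (mod int p)" if "int p = 5 * x^2 + 3 * y^2" "3 dvd y" for x y
    by (rule cong_trans[OF S fib_cong_5x2_3y2(1)[OF assms that]])
  moreover have "[?S = quot_mod p (- (x + y)) (2 * y)] (mod int p)"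
    if "int p = 5 * x^2 + 3 * y^2" "3 dvd y - x" for x y
    using coprime_denominator_form(1)[OF assms _ that(1)] coprime_small[OF assms, of 5]
    by (intro sum_choose_triple_cong_quot_mod assms fib_cong_5x2_3y2(2)[OF assms that]) simp
  ultimately show ?thesis using sum_choose_sextuple_cong_sum_choose_triple[OF assms] by blast
qed

end
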